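(* Let $H$ be a separable real Hilbert space with inner product $\langle\cdot,\cdot\rangle$ and norm $\|\cdot\|$, let $X$ be an $H$-valued random variable, and let $X_1,X_2,\ldots$ be i.i.d. copies of $X$. Assume that (i) for every $h\in H$ there exists $h'\in H$ with $\langle h,h'\rangle=0$ and $\mathrm{Var}(\langle h',X\rangle)>0$; (ii) there is a constant $C>0$ such that $\mathbb{E}[\|X-h\|^{-1}]\le C$ and $\mathbb{E}[\|X-h\|^{-2}]\le C$ for all $h\in H$. Let $m$ be the geometric median of $X$. Let $\alpha\in(1/2,1)$, $c_\gamma>0$, $\gamma_n=c_\gamma n^{-\alpha}$ for $n\ge 1$, let $Z_1$ be a bounded $\sigma(X_1)$-measurable $H$-valued random variable, and for $n\ge1$ let $$Z_{n+1}=Z_n+\gamma_n\frac{X_{n+1}-Z_n}{\|X_{n+1}-Z_n\|}.$$ Then there is a constant $K>0$ such that for all $\delta\in(0,1)$ there is a rank $n_\delta$ such that for all $n\ge n_\delta$, $$\mathbb{P}\left[\|Z_n-m\|\le\frac{K}{n^{\alpha/2}}\ln\left(\frac4\delta\right)\right]\ge 1-\delta.$$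
   Context: The geometric median of $X$ is $m:=\arg\min_{h\in H}\mathbb{E}[\|X-h\|-\|X\|]$; under (i) it is uniquely defined. Condition (ii) implies $\mathbb{P}(X=h)=0$ for every $h\in H$, so the recursion is almost surely well defined. *)

theory Defs
  imports "HOL-Probability.Probability"
begin

text \<open>Variance with values in \<open>[0, \<infinity>]\<close>. No moment condition is imposed on \<open>Y\<close>, and the
  library's \<open>variance\<close> is \<open>0\<close> whenever the defining integral diverges; here it is \<open>\<infinity>\<close> in
  that case, and also when the mean of \<open>Y\<close> does not exist.\<close>

definition ext_variance :: "'a measure \<Rightarrow> ('a \<Rightarrow> real) \<Rightarrow> ennreal" where
  "ext_variance M Y =
     (if integrable M Y
      then \<integral>\<^sup>+ \<omega>. ennreal ((Y \<omega> - integral\<^sup>L M Y)\<^sup>2) \<partial>M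
      else \<infinity>)"

text \<open>The integrand is bounded in absolute value by \<open>norm h\<close>, so the Bochner integral is the true
  expectation even when \<open>X\<close> has no first moment.\<close>

definition is_geometric_median ::
    "'a measure \<Rightarrow> ('a \<Rightarrow> 'h::{real_inner, complete_space, second_countable_topology}) \<Rightarrow> 'h \<Rightarrow> bool"
  where
  "is_geometric_median M X m \<longleftrightarrow>
     is_arg_min (\<lambda>h. integral\<^sup>L M (\<lambda>\<omega>. norm (X \<omega> - h) - norm (X \<omega>))) (\<lambda>_. True) m"

end

theory Submission
  imports Defs "HOL-Real_Asymp.Real_Asymp"
begin

text \<open>Write \<open>V\<^sub>n = Z\<^sub>n - m\<close> and \<open>u\<^sub>n\<^sub>+\<^sub>1 = sgn (X\<^sub>n\<^sub>+\<^sub>1 - Z\<^sub>n)\<close>, so that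
  \<open>V\<^sub>n\<^sub>+\<^sub>1 = V\<^sub>n + \<gamma>\<^sub>n u\<^sub>n\<^sub>+\<^sub>1\<close> with steps of norm at most \<open>\<gamma>\<^sub>n\<close>. The proof turns the boundedness of
  the directions \<open>u\<^sub>n\<close> into exponential moment bounds, and these give the logarithm of \<open>1 / \<delta>\<close>.

  The geometric input is that the mean direction points back to the median: with
  \<open>pull v = - E \<langle>v, sgn (X - m - v)\<rangle>\<close> there is \<open>c > 0\<close> such that
  \<open>pull v \<ge> c min(|v|\<^sup>2, |v|)\<close> for all \<open>v\<close> (\<open>pull_coercive\<close>). Inside the unit ball this is strong
  convexity of the objective, which in infinite dimension cannot come from compactness of
  the sphere. It comes instead from comparing \<open>X\<close> with an independent copy: if \<open>v\<close> were a
  nearly degenerate direction, then two independent copies of \<open>X - m\<close> would both be nearly parallel to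
  \<open>v\<close>, hence nearly parallel to each other, and the average deviation from that does not depend on
  \<open>v\<close>. Outside the unit ball the bound extends along rays by convexity.

  The stochastic input is Hoeffding's lemma for \<open>\<langle>V\<^sub>n, u\<^sub>n\<^sub>+\<^sub>1\<rangle>\<close> given the past: this variable lies in
  \<open>[-|V\<^sub>n|, |V\<^sub>n|]\<close>, so the quadratic term that it contributes to the exponent carries the
  factor \<open>|V\<^sub>n|\<^sup>2\<close> and is absorbed by the pull. It is used twice.

  First, with the potential \<open>sqrt (1 + |v|\<^sup>2) - 1\<close>, which is quadratic near the median and linear far
  away just as the pull is, and with the slowly growing parameter \<open>5 ln n\<close>: the exponential moments
  stay bounded because \<open>\<Sum> ln n \<gamma>\<^sub>n\<^sup>2 < \<infinity>\<close>, which is where \<open>\<alpha> > 1 / 2\<close> enters. Hence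
  \<open>P(|V\<^sub>n| > 1) = O(n\<^sup>-\<^sup>2)\<close> and almost surely the iterates eventually stay in the unit ball
  (\<open>tail_bound\<close>, \<open>localization\<close>).

  Second, with \<open>|v|\<^sup>2\<close> and the parameter \<open>\<lambda>\<^sub>n = c / (4 \<gamma>\<^sub>n)\<close>, on the event that the iterates have stayed
  in the unit ball since time \<open>N\<close>: the moments satisfy
  \<open>a\<^sub>n\<^sub>+\<^sub>1 \<le> (1 - \<epsilon>\<^sub>n) a\<^sub>n + \<epsilon>\<^sub>n e\<close> with \<open>\<epsilon>\<^sub>n = c \<gamma>\<^sub>n / 2\<close>, and since \<open>\<Sum> \<epsilon>\<^sub>n = \<infinity>\<close> they are eventually below
  \<open>e + 1\<close>, whatever \<open>N\<close> is (\<open>localized_exponential_moment\<close>). Markov's inequality then bounds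
  \<open>|V\<^sub>n|\<^sup>2\<close> by a multiple of \<open>\<gamma>\<^sub>n ln (4 / \<delta>)\<close>. Only \<open>N\<close>, hence only the rank, depends on \<open>\<delta>\<close>
  (\<open>confidence_ball\<close>).\<close>

section \<open>Gram determinants and the monotonicity of the direction field\<close>

definition gram :: "'h::real_inner \<Rightarrow> 'h \<Rightarrow> real" where
  "gram x y = (norm x)\<^sup>2 * (norm y)\<^sup>2 - (inner x y)\<^sup>2"

lemma gram_nonneg: "0 \<le> gram x y"
proof -
  have "(inner x y)\<^sup>2 \<le> (norm x * norm y)\<^sup>2"
    by (metis Cauchy_Schwarz_ineq2 abs_ge_zero power2_abs power_mono)
  then show ?thesis by (simp add: gram_def power_mult_distrib)
qed

lemma gram_le: "gram x y \<le> (norm x)\<^sup>2 * (norm y)\<^sup>2"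
  by (simp add: gram_def)

lemma gram_commute: "gram x y = gram y x"
  by (simp add: gram_def inner_commute mult.commute)

lemma gram_scaleR_left: "gram (t *\<^sub>R x) y = t\<^sup>2 * gram x y"
  by (simp add: gram_def power_mult_distrib algebra_simps)

lemma gram_eq_0_orthogonal:
  assumes "u \<noteq> 0" "gram u y = 0" "inner u h = 0"
  shows "inner h y = 0"
proof -
  have "inner (y - (inner u y / inner u u) *\<^sub>R u) (y - (inner u y / inner u u) *\<^sub>R u) = gram u y / inner u u"
    using assms(1) unfolding gram_def power2_norm_eq_inner
    by (simp add: inner_diff inner_commute power2_eq_square field_simps)
  then have "y = (inner u y / inner u u) *\<^sub>R u"
    using assms(2) by simp
  then show ?thesis
    using assms(3) by (metis inner_commute inner_scaleR_right mult_zero_right)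
qed

text \<open>The engine of the coercivity estimate: \<open>sqrt (gram v x)\<close> is \<open>|v|\<close> times the distance of \<open>x\<close> from
  the line through \<open>v\<close>, so if \<open>x\<close> and \<open>y\<close> are both close to that line then they are close to being
  collinear. For unit \<open>v\<close>, write \<open>x = a v + p\<close> and \<open>y = b v + r\<close> with \<open>p\<close>, \<open>r\<close> orthogonal to \<open>v\<close>.\<close>

lemma gram_triangle:
  "(norm v)\<^sup>2 * gram x y \<le> 2 * ((norm x)\<^sup>2 * gram v y + (norm y)\<^sup>2 * gram v x)"
proof (cases "v = 0")
  case False
  define e where "e = v /\<^sub>R norm v"
  have e: "inner e e = 1" and v: "v = norm v *\<^sub>R e"
    using False by (auto simp: e_def norm_eq_sqrt_inner divide_simps power2_eq_square[symmetric]) 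
  define a b where "a = inner e x" and "b = inner e y"
  define p r where "p = x - a *\<^sub>R e" and "r = y - b *\<^sub>R e"
  define P Q s where "P = (norm p)\<^sup>2" and "Q = (norm r)\<^sup>2" and "s = inner p r"
  have x2: "(norm x)\<^sup>2 = a\<^sup>2 + P" and y2: "(norm y)\<^sup>2 = b\<^sup>2 + Q" and xy: "inner x y = a * b + s"
    using e unfolding P_def Q_def s_def p_def r_def a_def b_def power2_norm_eq_inner
    by (simp_all add: inner_diff inner_commute power2_eq_square algebra_simps)
  have gx: "gram e x = P" and gy: "gram e y = Q"
    unfolding gram_def x2 y2 by (simp_all add: a_def b_def e power2_norm_eq_inner)
  have s: "s\<^sup>2 \<le> P * Q"
    using gram_nonneg[of p r] by (simp add: gram_def P_def Q_def s_def)
  have "0 \<le> P" "0 \<le> Q" by (simp_all add: P_def Q_def)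
  have "\<bar>a * b * s\<bar> * 2 \<le> a\<^sup>2 * Q + b\<^sup>2 * P"
  proof -
    have "\<bar>s\<bar> \<le> sqrt P * sqrt Q"
      using s by (metis real_sqrt_abs real_sqrt_le_mono real_sqrt_mult)
    then have "\<bar>a\<bar> * \<bar>b\<bar> * \<bar>s\<bar> \<le> \<bar>a\<bar> * \<bar>b\<bar> * (sqrt P * sqrt Q)"
      by (intro mult_left_mono) auto
    moreover have "0 \<le> (\<bar>a\<bar> * sqrt Q - \<bar>b\<bar> * sqrt P)\<^sup>2" by simp
    ultimately show ?thesis
      using \<open>0 \<le> P\<close> \<open>0 \<le> Q\<close>
      by (simp add: power2_diff power_mult_distrib abs_mult algebra_simps)
  qed
  then have "(a\<^sup>2 + P) * (b\<^sup>2 + Q) - (a * b + s)\<^sup>2 \<le> 2 * ((a\<^sup>2 + P) * Q + (b\<^sup>2 + Q) * P)"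
    using \<open>0 \<le> P\<close> \<open>0 \<le> Q\<close> mult_nonneg_nonneg[OF \<open>0 \<le> P\<close> \<open>0 \<le> Q\<close>] zero_le_power2[of s]
    by (simp add: power2_sum power_mult_distrib algebra_simps)
  then have "gram x y \<le> 2 * ((norm x)\<^sup>2 * gram e y + (norm y)\<^sup>2 * gram e x)"
    by (simp add: gx gy gram_def[of x y] x2 y2 xy)
  then have "(norm v)\<^sup>2 * gram x y \<le> (norm v)\<^sup>2 * (2 * ((norm x)\<^sup>2 * gram e y + (norm y)\<^sup>2 * gram e x))"
    by (intro mult_left_mono) auto
  also have "\<dots> = 2 * ((norm x)\<^sup>2 * gram v y + (norm y)\<^sup>2 * gram v x)"
  proof -
    have "gram v w = (norm v)\<^sup>2 * gram e w" for w
      by (subst v) (rule gram_scaleR_left)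
    then show ?thesis by (simp add: algebra_simps)
  qed
  finally show ?thesis .
qed (simp add: gram_def)

lemma inner_sgn_self: "inner x (sgn x) = norm x" for x :: "'h::real_inner"
  by (cases "x = 0") (simp_all add: sgn_div_norm power2_norm_eq_inner[symmetric] power2_eq_square)

lemma inner_sgn_le: "inner x (sgn y) \<le> norm x" for x y :: "'h::real_inner"
  using norm_cauchy_schwarz[of x "sgn y"] by (simp add: norm_sgn split: if_splits)

lemma abs_inner_sgn_le: "\<bar>inner x (sgn y)\<bar> \<le> norm x" for x y :: "'h::real_inner"
  using Cauchy_Schwarz_ineq2[of x "sgn y"] by (simp add: norm_sgn split: if_splits)

lemma sgn_monotone: "0 \<le> inner (y - z) (sgn y - sgn z)" for y z :: "'h::real_inner"
  using inner_sgn_le[of y z] inner_sgn_le[of z y]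
  by (simp add: inner_diff inner_sgn_self)

text \<open>The factor by which \<open>gram v y\<close> enters the lower bound for the monotonicity of \<open>sgn\<close>. At \<open>y = 0\<close>
  it is \<open>0\<close>, which is harmless there because \<open>gram v 0 = 0\<close>. The product \<open>weight y * (norm y)\<^sup>2\<close> is bounded, so
  weighted second moments are finite even for heavy-tailed laws.\<close>

definition weight :: "'h::real_inner \<Rightarrow> real" where
  "weight y = 1 / (2 * (norm y)\<^sup>2 * (1 + norm y))"

lemma weight_nonneg: "0 \<le> weight y"
  by (simp add: weight_def)

lemma weight_pos: "y \<noteq> 0 \<Longrightarrow> 0 < weight y"
  by (simp add: weight_def add_pos_nonneg)

lemma weight_norm_le: "weight y * (norm y)\<^sup>2 \<le> 1"
  by (cases "y = 0") (simp_all add: weight_def divide_simps add_pos_nonneg)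

text \<open>Let \<open>z = y - v\<close>, \<open>a = |y|\<close>, \<open>b = |z|\<close> and \<open>s = \<langle>y, z\<rangle>\<close>. If \<open>a\<close> and \<open>b\<close> are positive, the right-hand side is
  \<open>(a + b) (a b - s) / (a b)\<close>, while \<open>gram v y = gram y z = (a b - s) (a b + s)\<close>. The hypothesis on \<open>v\<close>
  serves to replace \<open>b\<close> by \<open>1 + a\<close>, so that the weight depends on \<open>y\<close> alone.\<close>

lemma sgn_strongly_monotone:
  fixes v y :: "'h::real_inner"
  assumes "norm v \<le> 1"
  shows "weight y * gram v y \<le> inner v (sgn y - sgn (y - v))"
proof (cases "y = 0 \<or> y = v")
  case True
  have "0 \<le> inner v (sgn y - sgn (y - v))"
    using sgn_monotone[of y "y - v"] by simp
  moreover from True have "weight y * gram v y = 0"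
    unfolding gram_def power2_norm_eq_inner by (auto simp: power2_eq_square)
  ultimately show ?thesis by linarith
next
  case False
  define z where "z = y - v"
  define a b s where "a = norm y" and "b = norm z" and "s = inner y z"
  have ab: "0 < a" "0 < b" using False by (auto simp: a_def b_def z_def)
  have v: "v = y - z" by (simp add: z_def)
  have s: "s \<le> a * b" unfolding s_def a_def b_def by (rule norm_cauchy_schwarz)
  have b: "b \<le> 1 + a"
    using norm_triangle_ineq4[of y v] assms by (simp add: a_def b_def z_def)
  have "inner v (sgn y - sgn z) = a + b - s / a - s / b"
    using ab unfolding v
    by (simp add: inner_diff inner_sgn_self a_def[symmetric] b_def[symmetric])
      (simp add: sgn_div_norm s_def a_def b_def inner_commute divide_inverse mult.commute)
  also have "\<dots> = (a + b) * (a * b - s) / (a * b)"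
    using ab by (simp add: field_simps)
  finally have 1: "inner v (sgn y - sgn z) = (a + b) * (a * b - s) / (a * b)" .
  have "gram v y = (a * b)\<^sup>2 - s\<^sup>2"
    unfolding gram_commute[of v y] a_def b_def s_def v
    unfolding gram_def power_mult_distrib power2_norm_eq_inner
    by (simp add: power2_eq_square inner_diff inner_commute algebra_simps)
  also have "\<dots> = (a * b - s) * (a * b + s)"
    by (simp add: power2_eq_square algebra_simps)
  also have "\<dots> \<le> (a * b - s) * (2 * (a * b))"
    using s by (intro mult_left_mono) auto
  finally have 2: "gram v y \<le> (a * b - s) * (2 * (a * b))" .
  have "weight y * gram v y \<le> weight y * ((a * b - s) * (2 * (a * b)))"
    by (intro mult_left_mono 2 weight_nonneg)
  also have "\<dots> = (a * b - s) / (a * b) * (b * b / (1 + a))"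
  proof -
    have "0 < 1 + a" using ab by simp
    then show ?thesis
      using ab unfolding weight_def a_def[symmetric] power2_eq_square
      by (simp add: divide_simps del: add_pos_pos)
  qed
  also have "\<dots> \<le> (a * b - s) / (a * b) * (a + b)"
  proof (intro mult_left_mono)
    have "b * b \<le> b * (1 + a)" using b ab by (intro mult_left_mono) auto
    then have "b * b / (1 + a) \<le> b" using ab by (simp add: divide_simps)
    then show "b * b / (1 + a) \<le> a + b" using ab by simp
  qed (use s ab in auto)
  finally show ?thesis unfolding 1 z_def[symmetric] by (simp add: mult.commute)
qed

section \<open>Coercivity of the mean direction\<close>

lemma borel_measurable_sgn_real_inner [measurable]:
  "(sgn :: 'h::{real_inner, second_countable_topology} \<Rightarrow> 'h) \<in> borel_measurable borel"
  unfolding sgn_div_norm by measurable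

lemma borel_measurable_gram [measurable]:
  fixes f g :: "'a \<Rightarrow> 'h::{real_inner, second_countable_topology}"
  assumes [measurable]: "f \<in> borel_measurable M" "g \<in> borel_measurable M"
  shows "(\<lambda>x. gram (f x) (g x)) \<in> borel_measurable M"
  unfolding gram_def by measurable

lemma borel_measurable_weight [measurable]:
  "(weight :: 'h::{real_inner, second_countable_topology} \<Rightarrow> real) \<in> borel_measurable borel"
  unfolding weight_def by measurable

text \<open>The law of \<open>X\<close> with the properties that the analysis of the mean direction uses. The
  assumption \<open>not_on_line\<close> says that \<open>X\<close> does not almost surely lie on a line through \<open>m\<close>.\<close>

locale median_law = prob_space P
  for P :: "'h::{real_inner, complete_space, second_countable_topology} measure" +
  fixes m :: 'h
  assumes sets_P [measurable_cong]: "sets P = sets borel"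
    and AE_noteq: "AE x in P. x \<noteq> m"
    and not_on_line: "u \<noteq> 0 \<Longrightarrow> \<not> (AE x in P. gram u (x - m) = 0)"
    and median: "(\<integral>x. norm (x - m) - norm x \<partial>P) \<le> (\<integral>x. norm (x - h) - norm x \<partial>P)"
begin

lemma integrable_bounded:
  fixes f :: "'h \<Rightarrow> real"
  assumes "f \<in> borel_measurable borel" "\<And>x. \<bar>f x\<bar> \<le> B"
  shows "integrable P f"
  by (rule integrable_const_bound[where B = B]) (use assms in \<open>auto simp: measurable_cong_sets[OF sets_P refl]\<close>)

lemma integrable_inner_sgn [simp]: "integrable P (\<lambda>x. inner v (sgn (x - h)))"
  by (rule integrable_bounded[where B = "norm v"]) (auto simp: abs_inner_sgn_le)

lemma integrable_norm_diff [simp]: "integrable P (\<lambda>x. norm (x - h) - norm x)"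
proof (rule integrable_bounded[where B = "norm h"])
  show "\<bar>norm (x - h) - norm x\<bar> \<le> norm h" for x
    using norm_triangle_ineq3[of "x - h" x] by simp
qed measurable

text \<open>The subgradient inequality \<open>|x - m| \<ge> \<langle>x - m, sgn (x - h)\<rangle>\<close> at \<open>h = m + t v\<close>, integrated and compared
  with the minimality of \<open>m\<close>.\<close>

lemma first_order_perturbed:
  assumes "t > 0"
  shows "(\<integral>x. inner v (sgn (x - (m + t *\<^sub>R v))) \<partial>P) \<le> 0"
proof -
  have "norm (x - (m + t *\<^sub>R v)) - norm x + t * inner v (sgn (x - (m + t *\<^sub>R v))) \<le> norm (x - m) - norm x" for x
    using inner_sgn_le[of "x - m" "x - (m + t *\<^sub>R v)"] inner_sgn_self[of "x - (m + t *\<^sub>R v)"]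
    by (simp add: inner_diff inner_add)
  then have "(\<integral>x. norm (x - (m + t *\<^sub>R v)) - norm x + t * inner v (sgn (x - (m + t *\<^sub>R v))) \<partial>P)
      \<le> (\<integral>x. norm (x - m) - norm x \<partial>P)"
    by (intro integral_mono Bochner_Integration.integrable_add integrable_mult_right
        integrable_norm_diff integrable_inner_sgn)
  also have "\<dots> \<le> (\<integral>x. norm (x - (m + t *\<^sub>R v)) - norm x \<partial>P)"
    by (rule median)
  finally have "t * (\<integral>x. inner v (sgn (x - (m + t *\<^sub>R v))) \<partial>P) \<le> 0"
    by (subst (asm) Bochner_Integration.integral_add) (simp_all del: Bochner_Integration.integral_diff)
  then show ?thesis using assms by (simp add: mult_le_0_iff)
qed

text \<open>Only this inequality for all \<open>v\<close> is needed, so instead of differentiating the objective at \<open>m\<close>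
  one passes to the limit in \<open>first_order_perturbed\<close>; the integrands converge because \<open>X\<close> has no
  atom at \<open>m\<close>.\<close>

lemma first_order: "(\<integral>x. inner v (sgn (x - m)) \<partial>P) \<le> 0"
proof -
  define t :: "nat \<Rightarrow> real" where "t n = inverse (real (Suc n))" for n
  have t: "t \<longlonglongrightarrow> 0" "t n > 0" for n
    using LIMSEQ_inverse_real_of_nat by (auto simp: t_def[abs_def])
  have "(\<lambda>n. \<integral>x. inner v (sgn (x - (m + t n *\<^sub>R v))) \<partial>P) \<longlonglongrightarrow> (\<integral>x. inner v (sgn (x - m)) \<partial>P)"
  proof (rule integral_dominated_convergence[where w = "\<lambda>_. norm v"])
    show "AE x in P. (\<lambda>n. inner v (sgn (x - (m + t n *\<^sub>R v)))) \<longlonglongrightarrow> inner v (sgn (x - m))"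
      using AE_noteq
    proof eventually_elim
      case (elim x)
      have "(\<lambda>n. x - (m + t n *\<^sub>R v)) \<longlonglongrightarrow> x - (m + 0 *\<^sub>R v)"
        by (intro tendsto_intros t)
      then show ?case
        using elim by (intro tendsto_inner tendsto_const tendsto_sgn) auto
    qed
  qed (auto simp: abs_inner_sgn_le)
  then show ?thesis
    by (rule LIMSEQ_le_const2) (use first_order_perturbed t(2) in blast)
qed

text \<open>A quadratic form in \<open>v\<close> that plays the role of the Hessian of the objective at \<open>m\<close> and bounds the
  drift from below on the whole unit ball.\<close>

definition spread :: "'h \<Rightarrow> real" where
  "spread v = (\<integral>x. weight (x - m) * gram v (x - m) \<partial>P)"

lemma weighted_gram_le: "weight y * gram v y \<le> (norm v)\<^sup>2"
proof -
  have "weight y * gram v y \<le> weight y * ((norm v)\<^sup>2 * (norm y)\<^sup>2)"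
    by (intro mult_left_mono gram_le weight_nonneg)
  also have "\<dots> = (norm v)\<^sup>2 * (weight y * (norm y)\<^sup>2)" by simp
  also have "\<dots> \<le> (norm v)\<^sup>2 * 1"
    by (intro mult_left_mono weight_norm_le) auto
  finally show ?thesis by simp
qed

lemma integrable_weighted_gram [simp]: "integrable P (\<lambda>x. weight (x - m) * gram v (x - m))"
  by (rule integrable_bounded[where B = "(norm v)\<^sup>2"])
    (use weighted_gram_le in \<open>auto simp: abs_mult weight_nonneg gram_nonneg\<close>)

lemma integrable_weighted_norm [simp]: "integrable P (\<lambda>x. weight (x - m) * (norm (x - m))\<^sup>2)"
  by (rule integrable_bounded[where B = 1])
    (use weight_norm_le in \<open>auto simp: abs_mult weight_nonneg\<close>)

lemma spread_bounds: "0 \<le> spread v" "spread v \<le> (norm v)\<^sup>2"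
proof -
  show "0 \<le> spread v" unfolding spread_def
    by (intro integral_nonneg_AE always_eventually allI mult_nonneg_nonneg weight_nonneg gram_nonneg)
  have "spread v \<le> (\<integral>x. (norm v)\<^sup>2 \<partial>P)" unfolding spread_def
    by (intro integral_mono weighted_gram_le) auto
  then show "spread v \<le> (norm v)\<^sup>2" by (simp add: prob_space)
qed

lemma spread_pos:
  assumes "u \<noteq> 0"
  shows "0 < spread u"
proof (rule ccontr)
  assume "\<not> 0 < spread u"
  then have "spread u = 0" using spread_bounds(1)[of u] by simp
  then have "AE x in P. weight (x - m) * gram u (x - m) = 0"
    unfolding spread_def
    by (subst (asm) integral_nonneg_eq_0_iff_AE) (auto simp: weight_nonneg gram_nonneg)
  with AE_noteq have "AE x in P. gram u (x - m) = 0"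
  proof eventually_elim
    case (elim x)
    then show ?case using weight_pos[of "x - m"] by auto
  qed
  then show False using not_on_line[OF assms] by simp
qed

lemma borel_measurable_spread [measurable]: "spread \<in> borel_measurable borel"
proof -
  interpret sigma_finite_measure P by unfold_locales
  have "(\<lambda>v. \<integral>x. weight (x - m) * gram v (x - m) \<partial>P) \<in> borel_measurable borel"
    by (rule borel_measurable_lebesgue_integral) measurable
  then show ?thesis unfolding spread_def[abs_def] .
qed

text \<open>Pointwise, \<open>spread v\<close> is positive for \<open>v \<noteq> 0\<close>; the uniform bound needs an argument that works
  without compactness. Integrating \<open>gram_triangle\<close> once against the law gives
  \<open>|v|\<^sup>2 spread y \<le> 2 (|y|\<^sup>2 spread v + \<tau> gram v y)\<close>, and integrating again over \<open>y = X - m\<close> gives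
  \<open>\<rho> |v|\<^sup>2 \<le> 4 \<tau> spread v\<close>, where \<open>\<rho> > 0\<close> and \<open>\<tau>\<close> do not depend on \<open>v\<close>.\<close>

lemma spread_coercive: "\<exists>c>0. \<forall>v. c * (norm v)\<^sup>2 \<le> spread v"
proof -
  define \<tau> where "\<tau> = (\<integral>x. weight (x - m) * (norm (x - m))\<^sup>2 \<partial>P)"
  define \<rho> where "\<rho> = (\<integral>x. weight (x - m) * spread (x - m) \<partial>P)"
  have int: "integrable P (\<lambda>x. weight (x - m) * spread (x - m))"
  proof (rule integrable_bounded[where B = 1])
    show "\<bar>weight (x - m) * spread (x - m)\<bar> \<le> 1" for x
      using mult_left_mono[OF spread_bounds(2)[of "x - m"] weight_nonneg[of "x - m"]]
        weight_norm_le[of "x - m"] spread_bounds(1)[of "x - m"] weight_nonneg[of "x - m"]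
      by (simp add: abs_mult)
  qed measurable
  have "0 < \<rho>"
  proof -
    have "0 \<le> \<rho>" unfolding \<rho>_def
      by (intro integral_nonneg_AE always_eventually allI mult_nonneg_nonneg weight_nonneg spread_bounds)
    moreover have "\<rho> \<noteq> 0"
    proof
      assume "\<rho> = 0"
      then have "AE x in P. weight (x - m) * spread (x - m) = 0"
        unfolding \<rho>_def using int
        by (subst (asm) integral_nonneg_eq_0_iff_AE) (auto simp: weight_nonneg spread_bounds)
      with AE_noteq have "AE x in P. False"
      proof eventually_elim
        case (elim x)
        then show ?case using weight_pos[of "x - m"] spread_pos[of "x - m"] by auto
      qed
      then show False by simp
    qed
    ultimately show ?thesis by simp
  qed
  have main: "\<rho> * (norm v)\<^sup>2 \<le> 4 * \<tau> * spread v" for v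
  proof -
    have 1: "(norm v)\<^sup>2 * spread y \<le> 2 * ((norm y)\<^sup>2 * spread v + \<tau> * gram v y)" for y
    proof -
      have "(norm v)\<^sup>2 * spread y = (\<integral>x. weight (x - m) * ((norm v)\<^sup>2 * gram y (x - m)) \<partial>P)"
        unfolding spread_def integral_mult_right_zero[symmetric]
        by (intro Bochner_Integration.integral_cong) (auto simp: algebra_simps)
      also have "\<dots> \<le> (\<integral>x. 2 * ((norm y)\<^sup>2 * (weight (x - m) * gram v (x - m))
          + (weight (x - m) * (norm (x - m))\<^sup>2) * gram v y) \<partial>P)"
      proof (intro integral_mono)
        show "weight (x - m) * ((norm v)\<^sup>2 * gram y (x - m)) \<le> 2 * ((norm y)\<^sup>2 * (weight (x - m) * gram v (x - m))
          + (weight (x - m) * (norm (x - m))\<^sup>2) * gram v y)" for x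
          using mult_left_mono[OF gram_triangle[of v y "x - m"] weight_nonneg[of "x - m"]]
          by (simp add: algebra_simps)
        show "integrable P (\<lambda>x. weight (x - m) * ((norm v)\<^sup>2 * gram y (x - m)))"
          using integrable_mult_right[OF integrable_weighted_gram[of y], of "(norm v)\<^sup>2"]
          by (simp add: mult.left_commute)
      qed (intro integrable_mult_right integrable_mult_left
        Bochner_Integration.integrable_add integrable_weighted_gram integrable_weighted_norm)
      also have "\<dots> = 2 * ((norm y)\<^sup>2 * spread v + \<tau> * gram v y)"
        unfolding spread_def \<tau>_def by simp
      finally show ?thesis .
    qed
    have "\<rho> * (norm v)\<^sup>2 = (\<integral>x. weight (x - m) * ((norm v)\<^sup>2 * spread (x - m)) \<partial>P)"
      unfolding \<rho>_def integral_mult_left_zero[symmetric]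
      by (intro Bochner_Integration.integral_cong) (auto simp: algebra_simps)
    also have "\<dots> \<le> (\<integral>x. 2 * ((weight (x - m) * (norm (x - m))\<^sup>2) * spread v
        + \<tau> * (weight (x - m) * gram v (x - m))) \<partial>P)"
    proof (intro integral_mono)
      show "weight (x - m) * ((norm v)\<^sup>2 * spread (x - m)) \<le> 2 * ((weight (x - m) * (norm (x - m))\<^sup>2) * spread v
        + \<tau> * (weight (x - m) * gram v (x - m)))" for x
        using mult_left_mono[OF 1[of "x - m"] weight_nonneg[of "x - m"]]
        by (simp add: algebra_simps)
      show "integrable P (\<lambda>x. weight (x - m) * ((norm v)\<^sup>2 * spread (x - m)))"
        using integrable_mult_right[OF int, of "(norm v)\<^sup>2"] by (simp add: mult.left_commute)
    qed (intro integrable_mult_right integrable_mult_left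
        Bochner_Integration.integrable_add integrable_weighted_gram integrable_weighted_norm)
    also have "\<dots> = 4 * \<tau> * spread v"
      unfolding spread_def \<tau>_def by simp
    finally show ?thesis .
  qed
  have "0 \<le> \<tau>" unfolding \<tau>_def
    by (intro integral_nonneg_AE always_eventually allI mult_nonneg_nonneg weight_nonneg) auto
  \<comment> \<open>The summand \<open>1\<close> spares a proof that \<open>\<tau>\<close> is positive.\<close>
  have "0 < \<rho> / (4 * \<tau> + 1)" using \<open>0 < \<rho>\<close> \<open>0 \<le> \<tau>\<close> by simp
  moreover have "\<rho> / (4 * \<tau> + 1) * (norm v)\<^sup>2 \<le> spread v" for v
  proof -
    have "\<rho> * (norm v)\<^sup>2 \<le> (4 * \<tau> + 1) * spread v"
      using main[of v] spread_bounds(1)[of v] by (simp add: algebra_simps)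
    then show ?thesis using \<open>0 \<le> \<tau>\<close> by (simp add: divide_simps mult.commute)
  qed
  ultimately show ?thesis by blast
qed

text \<open>The expected decrease of half the squared distance to \<open>m\<close> per unit of step size at the point
  \<open>m + v\<close>, to first order; equivalently \<open>v\<close> paired with the gradient of the objective there.\<close>

definition pull :: "'h \<Rightarrow> real" where
  "pull v = - (\<integral>x. inner v (sgn (x - (m + v))) \<partial>P)"

lemma pull_ge_spread:
  assumes "norm v \<le> 1"
  shows "spread v \<le> pull v"
proof -
  have "spread v \<le> (\<integral>x. inner v (sgn (x - m)) - inner v (sgn (x - (m + v))) \<partial>P)"
    unfolding spread_def
  proof (intro integral_mono)
    show "weight (x - m) * gram v (x - m) \<le> inner v (sgn (x - m)) - inner v (sgn (x - (m + v)))" for x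
      using sgn_strongly_monotone[OF assms, of "x - m"] by (simp add: inner_diff diff_diff_eq)
  qed (auto intro: Bochner_Integration.integrable_diff)
  also have "\<dots> \<le> pull v"
    using first_order[of v] by (simp add: pull_def)
  finally show ?thesis .
qed

text \<open>The derivative of a convex function along a ray is nondecreasing; this carries bounds on the unit sphere
  outwards.\<close>

lemma pull_radial:
  assumes "norm v \<ge> 1"
  shows "norm v * pull (sgn v) \<le> pull v"
proof -
  define e r where "e = sgn v" and "r = norm v"
  have v: "v = r *\<^sub>R e" and r: "1 \<le> r"
    using assms by (cases "v = 0"; simp add: e_def r_def sgn_div_norm)+
  have "inner e (sgn (x - (m + r *\<^sub>R e))) \<le> inner e (sgn (x - (m + e)))" for x
  proof (cases "r = 1")
    case False
    have "0 \<le> (r - 1) * inner e (sgn (x - (m + e)) - sgn (x - (m + r *\<^sub>R e)))"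
      using sgn_monotone[of "x - (m + e)" "x - (m + r *\<^sub>R e)"]
      by (simp add: inner_diff algebra_simps)
    then show ?thesis using False r by (simp add: zero_le_mult_iff inner_diff)
  qed simp
  then have "pull e \<le> - (\<integral>x. inner e (sgn (x - (m + r *\<^sub>R e))) \<partial>P)"
    unfolding pull_def by (auto intro!: integral_mono)
  then have "r * pull e \<le> r * - (\<integral>x. inner e (sgn (x - (m + r *\<^sub>R e))) \<partial>P)"
    using r by (intro mult_left_mono) auto
  also have "\<dots> = pull v" unfolding pull_def v by simp
  finally show ?thesis by (simp add: e_def r_def)
qed

lemma pull_coercive: "\<exists>c>0. \<forall>v. c * min ((norm v)\<^sup>2) (norm v) \<le> pull v"
proof -
  obtain c where c: "c > 0" "\<And>v. c * (norm v)\<^sup>2 \<le> spread v"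
    using spread_coercive by blast
  have "c * min ((norm v)\<^sup>2) (norm v) \<le> pull v" for v
  proof (cases "norm v \<le> 1")
    case True
    have "c * min ((norm v)\<^sup>2) (norm v) \<le> c * (norm v)\<^sup>2"
      using c by (intro mult_left_mono) auto
    then show ?thesis using c(2)[of v] pull_ge_spread[OF True] by linarith
  next
    case False
    have "c \<le> pull (sgn v)"
      using c(2)[of "sgn v"] pull_ge_spread[of "sgn v"] False by (auto simp: norm_sgn split: if_splits)
    then have "norm v * c \<le> norm v * pull (sgn v)" by (intro mult_left_mono) auto
    moreover have "c * min ((norm v)\<^sup>2) (norm v) \<le> c * norm v" using c by (intro mult_left_mono) auto
    ultimately show ?thesis using pull_radial[of v] False by (simp add: mult.commute)
  qed
  then show ?thesis using c(1) by blast
qed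

text \<open>Hoeffding's lemma for a variable in \<open>[-|v|, |v|]\<close> with mean \<open>- pull v\<close>.\<close>

lemma exp_pull:
  assumes "\<theta> > 0"
  shows "(\<integral>\<^sup>+x. ennreal (exp (\<theta> * inner v (sgn (x - (m + v))))) \<partial>P)
    \<le> ennreal (exp (- \<theta> * pull v + \<theta>\<^sup>2 * (norm v)\<^sup>2 / 2))"
proof -
  define f where "f x = inner v (sgn (x - (m + v)))" for x
  have fb: "\<bar>f x\<bar> \<le> norm v" for x unfolding f_def by (rule abs_inner_sgn_le)
  have [measurable]: "f \<in> borel_measurable P" unfolding f_def by measurable
  have f: "integrable P f" unfolding f_def by simp
  have E: "expectation f = - pull v" by (simp add: pull_def f_def[abs_def])
  interpret interval_bounded_random_variable P "\<lambda>x. f x - expectation f" "- norm v - expectation f" "norm v - expectation f"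
    by unfold_locales (use fb in \<open>auto simp: abs_le_iff minus_le_iff\<close>)
  have "(\<integral>\<^sup>+x. ennreal (exp (\<theta> * (f x - expectation f))) \<partial>P)
      \<le> ennreal (exp (\<theta>\<^sup>2 * ((norm v - expectation f) - (- norm v - expectation f))\<^sup>2 / 8))"
    by (rule Hoeffdings_lemma_nn_integral_0[OF assms]) (use f in \<open>simp add: prob_space\<close>)
  also have "\<dots> = ennreal (exp (\<theta>\<^sup>2 * (norm v)\<^sup>2 / 2))"
    by (simp add: power2_eq_square algebra_simps)
  finally have H: "(\<integral>\<^sup>+x. ennreal (exp (\<theta> * (f x - expectation f))) \<partial>P) \<le> ennreal (exp (\<theta>\<^sup>2 * (norm v)\<^sup>2 / 2))" .
  have "(\<integral>\<^sup>+x. ennreal (exp (\<theta> * f x)) \<partial>P)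
      = (\<integral>\<^sup>+x. ennreal (exp (\<theta> * expectation f)) * ennreal (exp (\<theta> * (f x - expectation f))) \<partial>P)"
    by (simp add: ennreal_mult'[symmetric] exp_add[symmetric] algebra_simps)
  also have "\<dots> = ennreal (exp (\<theta> * expectation f)) * (\<integral>\<^sup>+x. ennreal (exp (\<theta> * (f x - expectation f))) \<partial>P)"
    by (rule nn_integral_cmult) measurable
  also have "\<dots> \<le> ennreal (exp (\<theta> * expectation f)) * ennreal (exp (\<theta>\<^sup>2 * (norm v)\<^sup>2 / 2))"
    by (intro mult_left_mono H) auto
  also have "\<dots> = ennreal (exp (- \<theta> * pull v + \<theta>\<^sup>2 * (norm v)\<^sup>2 / 2))"
    by (simp add: ennreal_mult'[symmetric] exp_add[symmetric] E)
  finally show ?thesis by (simp add: f_def)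
qed

end

section \<open>Exponential moments after one step\<close>

text \<open>Quadratic near \<open>0\<close> and linear at infinity, like the lower bound for the pull; the bounded slope
  keeps exponential moments under control far from the median.\<close>

definition pot :: "'h::real_inner \<Rightarrow> real" where
  "pot v = sqrt (1 + (norm v)\<^sup>2) - 1"

lemma borel_measurable_pot [measurable]:
  "(pot :: 'h::{real_inner, second_countable_topology} \<Rightarrow> real) \<in> borel_measurable borel"
  unfolding pot_def by measurable

lemma pot_nonneg: "0 \<le> pot v"
  by (simp add: pot_def)

lemma pot_le_norm: "pot v \<le> norm v"
proof -
  have "sqrt (1 + (norm v)\<^sup>2) \<le> 1 + norm v"
    by (rule real_le_lsqrt) (auto simp: power2_eq_square algebra_simps)
  then show ?thesis by (simp add: pot_def)
qed

text \<open>\<open>2 / 5\<close> is a rational number below \<open>sqrt 2 - 1\<close>; with the parameter \<open>5 ln n\<close> it gives tails of order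
  \<open>n\<^sup>-\<^sup>2\<close>.\<close>

lemma pot_gt:
  assumes "1 < norm v"
  shows "2 / 5 < pot v"
proof -
  have "(7 / 5)\<^sup>2 < 1 + (norm v)\<^sup>2"
    using power_strict_mono[OF assms, of 2] by (simp add: power2_eq_square)
  then have "7 / 5 < sqrt (1 + (norm v)\<^sup>2)"
    using real_less_rsqrt by blast
  then show ?thesis by (simp add: pot_def)
qed

lemma pull_over_pot:
  "min (pot v) (1 / 2) \<le> min ((norm v)\<^sup>2) (norm v) / sqrt (1 + (norm v)\<^sup>2)"
proof -
  define r s where "r = norm v" and "s = sqrt (1 + r\<^sup>2)"
  have r: "0 \<le> r" and s: "1 \<le> s" "s\<^sup>2 = 1 + r\<^sup>2" by (auto simp: r_def s_def)
  show ?thesis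
  proof (cases "r \<le> 1")
    case True
    have "(s - 1) * s \<le> r\<^sup>2"
      using s by (simp add: power2_eq_square algebra_simps)
    then have "s - 1 \<le> r\<^sup>2 / s" using s by (simp add: pos_le_divide_eq)
    moreover have "min (r\<^sup>2) r = r\<^sup>2" using True r by (simp add: min_def power2_eq_square mult_left_le)
    ultimately show ?thesis by (simp add: pot_def r_def[symmetric] s_def[symmetric])
  next
    case False
    have "s \<le> 2 * r"
      unfolding s_def by (rule real_le_lsqrt) (use False r power_mono[of 1 r 2] in \<open>auto simp: power2_eq_square\<close>)
    then have "1 / 2 \<le> r / s" using s by (simp add: divide_simps)
    moreover have "min (r\<^sup>2) r = r" using False by (simp add: min_def power2_eq_square)
    ultimately show ?thesis
      unfolding r_def[symmetric] s_def[symmetric] by (simp only: min.coboundedI2)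
  qed
qed

lemma norm_step_le:
  fixes v u :: "'h::real_inner"
  assumes "0 \<le> t"
  shows "(norm (v + t *\<^sub>R sgn u))\<^sup>2 \<le> (norm v)\<^sup>2 + 2 * t * inner v (sgn u) + t\<^sup>2"
proof -
  have "inner (sgn u) (sgn u) \<le> 1"
    by (simp add: power2_norm_eq_inner[symmetric] norm_sgn)
  then have "t\<^sup>2 * inner (sgn u) (sgn u) \<le> t\<^sup>2 * 1" by (intro mult_left_mono) auto
  then show ?thesis
    unfolding power2_norm_eq_inner by (simp add: inner_add inner_commute power2_eq_square algebra_simps)
qed

text \<open>The tangent line bound for the square root at \<open>1 + |v|\<^sup>2\<close>, combined with \<open>norm_step_le\<close>.\<close>

lemma pot_step_le:
  assumes "0 \<le> t"
  shows "pot (v + t *\<^sub>R sgn u) \<le> pot v + t * inner v (sgn u) / sqrt (1 + (norm v)\<^sup>2) + t\<^sup>2 / 2"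
proof -
  define A A' where "A = sqrt (1 + (norm v)\<^sup>2)" and "A' = sqrt (1 + (norm (v + t *\<^sub>R sgn u))\<^sup>2)"
  have A: "1 \<le> A" "A\<^sup>2 = 1 + (norm v)\<^sup>2" "A'\<^sup>2 = 1 + (norm (v + t *\<^sub>R sgn u))\<^sup>2"
    by (auto simp: A_def A'_def)
  have "0 \<le> (A' - A)\<^sup>2" by simp
  then have "2 * A * A' \<le> 2 * A * A + (A'\<^sup>2 - A\<^sup>2)"
    by (simp add: power2_eq_square algebra_simps)
  also have "\<dots> \<le> 2 * A * A + (2 * t * inner v (sgn u) + t\<^sup>2)"
    using norm_step_le[OF assms, of v u] A by simp
  finally have "A' \<le> A + t * inner v (sgn u) / A + t\<^sup>2 / (2 * A)"
    using A by (simp add: field_simps)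
  moreover have "t\<^sup>2 / (2 * A) \<le> t\<^sup>2 / 2"
    using A(1) by (intro divide_left_mono) auto
  ultimately show ?thesis
    by (simp add: pot_def A_def[symmetric] A'_def[symmetric])
qed

context median_law begin

text \<open>The exponent parameter grows from \<open>l\<close> to \<open>l'\<close> during the step. The condition \<open>l' t \<le> c\<close> lets
  half of the pull absorb the quadratic term of Hoeffding's lemma; the other half pays for the
  growth of the parameter, as \<open>growth\<close> requires.\<close>

lemma exp_pot_step:
  assumes c: "\<And>v. c * min ((norm v)\<^sup>2) (norm v) \<le> pull v"
    and "0 < t" "0 < l'" "l' * t \<le> c"
    and growth: "(l' - l) * pot (z - m) \<le> l' * t * (c / 2) * min (pot (z - m)) (1 / 2)"
  shows "(\<integral>\<^sup>+x. ennreal (exp (l' * pot (z + t *\<^sub>R sgn (x - z) - m))) \<partial>P)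
    \<le> ennreal (exp (l * pot (z - m) + l' * t\<^sup>2 / 2))"
proof -
  define v where "v = z - m"
  have z: "z = m + v" by (simp add: v_def)
  define A where "A = sqrt (1 + (norm v)\<^sup>2)"
  \<comment> \<open>\<open>q\<close> is the lower bound for the pull, rescaled by the derivative of the potential.\<close>
  define q where "q = min ((norm v)\<^sup>2) (norm v) / A"
  define \<theta> where "\<theta> = l' * t / A"
  have A: "1 \<le> A" "A\<^sup>2 = 1 + (norm v)\<^sup>2" by (auto simp: A_def)
  have "0 < \<theta>" using assms A by (simp add: \<theta>_def)
  have "(\<integral>\<^sup>+x. ennreal (exp (l' * pot (z + t *\<^sub>R sgn (x - z) - m))) \<partial>P)
      \<le> (\<integral>\<^sup>+x. ennreal (exp (l' * pot v + l' * t\<^sup>2 / 2)) * ennreal (exp (\<theta> * inner v (sgn (x - (m + v))))) \<partial>P)"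
  proof (rule nn_integral_mono)
    fix x
    have "l' * pot (v + t *\<^sub>R sgn (x - z)) \<le> l' * (pot v + t * inner v (sgn (x - z)) / A + t\<^sup>2 / 2)"
      using pot_step_le[of t v "x - z"] assms unfolding A_def by (intro mult_left_mono) auto
    then show "ennreal (exp (l' * pot (z + t *\<^sub>R sgn (x - z) - m)))
      \<le> ennreal (exp (l' * pot v + l' * t\<^sup>2 / 2)) * ennreal (exp (\<theta> * inner v (sgn (x - (m + v)))))"
      by (simp add: ennreal_mult'[symmetric] exp_add[symmetric] z \<theta>_def algebra_simps)
  qed
  also have "\<dots> = ennreal (exp (l' * pot v + l' * t\<^sup>2 / 2)) * (\<integral>\<^sup>+x. ennreal (exp (\<theta> * inner v (sgn (x - (m + v))))) \<partial>P)"
    by (rule nn_integral_cmult) measurable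
  also have "\<dots> \<le> ennreal (exp (l' * pot v + l' * t\<^sup>2 / 2)) * ennreal (exp (- \<theta> * pull v + \<theta>\<^sup>2 * (norm v)\<^sup>2 / 2))"
    by (intro mult_left_mono exp_pull \<open>0 < \<theta>\<close>) auto
  also have "\<dots> \<le> ennreal (exp (l * pot v + l' * t\<^sup>2 / 2))"
  proof -
    have "\<theta> * (c * min ((norm v)\<^sup>2) (norm v)) \<le> \<theta> * pull v"
      using c[of v] \<open>0 < \<theta>\<close> by (intro mult_left_mono) auto
    then have 1: "l' * t * c * q \<le> \<theta> * pull v"
      by (simp add: \<theta>_def q_def algebra_simps)
    have 2: "(norm v)\<^sup>2 / A\<^sup>2 \<le> q"
    proof -
      have "(norm v)\<^sup>2 / A\<^sup>2 = ((norm v)\<^sup>2 / A) / A" by (simp add: power2_eq_square)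
      also have "\<dots> \<le> min ((norm v)\<^sup>2) (norm v) / A"
      proof (intro divide_right_mono)
        have "norm v \<le> A" unfolding A_def by (rule real_le_rsqrt) simp
        then have "(norm v)\<^sup>2 / A \<le> norm v"
          using A(1) by (simp add: divide_simps power2_eq_square mult_left_mono)
        moreover have "(norm v)\<^sup>2 / A \<le> (norm v)\<^sup>2"
          using A(1) by (simp add: divide_simps mult_left_le mult_le_cancel_left1)
        ultimately show "(norm v)\<^sup>2 / A \<le> min ((norm v)\<^sup>2) (norm v)" by simp
      qed (use A in auto)
      finally show ?thesis by (simp add: q_def)
    qed
    have "0 \<le> q" using A by (simp add: q_def)
    have "0 < c" using assms(2-4) by (smt (verit) mult_pos_pos)
    have "\<theta>\<^sup>2 * (norm v)\<^sup>2 / 2 = (l' * t) * (l' * t) * ((norm v)\<^sup>2 / A\<^sup>2) / 2"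
      by (simp add: \<theta>_def power2_eq_square)
    also have "\<dots> \<le> (l' * t) * c * q / 2"
      using assms(2-4) 2 \<open>0 \<le> q\<close> \<open>0 < c\<close> by (intro divide_right_mono mult_mono) auto
    finally have 3: "\<theta>\<^sup>2 * (norm v)\<^sup>2 / 2 \<le> (l' * t) * c * q / 2" .
    have "l' * t * (c / 2) * min (pot v) (1 / 2) \<le> l' * t * (c / 2) * q"
      using pull_over_pot[of v] assms(2-4) \<open>0 < c\<close> unfolding q_def A_def by (intro mult_left_mono) auto
    with growth have "(l' - l) * pot v \<le> l' * t * c * q / 2" by (simp add: v_def)
    with 1 3 have "l' * pot v + - \<theta> * pull v + \<theta>\<^sup>2 * (norm v)\<^sup>2 / 2 \<le> l * pot v"
      by (simp add: algebra_simps)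
    then show ?thesis by (simp add: ennreal_mult'[symmetric] exp_add[symmetric])
  qed
  finally show ?thesis by (simp add: v_def)
qed

text \<open>Here half of the pull absorbs the noise and the other half contracts the exponent by
  \<open>1 - c t\<close>, which \<open>growth\<close> compares with the growth of the parameter. What remains is
  \<open>exp ((1 - e) x + e \<cdot> 1)\<close>, and convexity of \<open>exp\<close> turns it into an affine recursion for the
  moments themselves.\<close>

lemma exp_norm_step:
  assumes c: "\<And>v. c * min ((norm v)\<^sup>2) (norm v) \<le> pull v"
    and "0 < t" "0 < l'" "2 * l' * t \<le> c" "norm (z - m) \<le> 1"
    and growth: "l' * (1 - c * t) \<le> l * (1 - e)" and noise: "l' * t\<^sup>2 \<le> e" and e: "0 \<le> e" "e \<le> 1"
  shows "(\<integral>\<^sup>+x. ennreal (exp (l' * (norm (z + t *\<^sub>R sgn (x - z) - m))\<^sup>2)) \<partial>P)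
    \<le> ennreal ((1 - e) * exp (l * (norm (z - m))\<^sup>2) + e * exp 1)"
proof -
  define v where "v = z - m"
  have z: "z = m + v" by (simp add: v_def)
  define \<theta> where "\<theta> = 2 * l' * t"
  have "0 < \<theta>" using assms by (simp add: \<theta>_def)
  have "(\<integral>\<^sup>+x. ennreal (exp (l' * (norm (z + t *\<^sub>R sgn (x - z) - m))\<^sup>2)) \<partial>P)
      \<le> (\<integral>\<^sup>+x. ennreal (exp (l' * (norm v)\<^sup>2 + l' * t\<^sup>2)) * ennreal (exp (\<theta> * inner v (sgn (x - (m + v))))) \<partial>P)"
  proof (rule nn_integral_mono)
    fix x
    have "l' * (norm (v + t *\<^sub>R sgn (x - z)))\<^sup>2 \<le> l' * ((norm v)\<^sup>2 + 2 * t * inner v (sgn (x - z)) + t\<^sup>2)"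
      using norm_step_le[of t v "x - z"] assms by (intro mult_left_mono) auto
    then show "ennreal (exp (l' * (norm (z + t *\<^sub>R sgn (x - z) - m))\<^sup>2))
      \<le> ennreal (exp (l' * (norm v)\<^sup>2 + l' * t\<^sup>2)) * ennreal (exp (\<theta> * inner v (sgn (x - (m + v)))))"
      by (simp add: ennreal_mult'[symmetric] exp_add[symmetric] z \<theta>_def algebra_simps)
  qed
  also have "\<dots> = ennreal (exp (l' * (norm v)\<^sup>2 + l' * t\<^sup>2)) * (\<integral>\<^sup>+x. ennreal (exp (\<theta> * inner v (sgn (x - (m + v))))) \<partial>P)"
    by (rule nn_integral_cmult) measurable
  also have "\<dots> \<le> ennreal (exp (l' * (norm v)\<^sup>2 + l' * t\<^sup>2)) * ennreal (exp (- \<theta> * pull v + \<theta>\<^sup>2 * (norm v)\<^sup>2 / 2))"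
    by (intro mult_left_mono exp_pull \<open>0 < \<theta>\<close>) auto
  also have "\<dots> = ennreal (exp (l' * (norm v)\<^sup>2 + l' * t\<^sup>2 - \<theta> * pull v + \<theta>\<^sup>2 * (norm v)\<^sup>2 / 2))"
    by (simp add: ennreal_mult'[symmetric] exp_add[symmetric])
  also have "\<dots> \<le> ennreal (exp ((1 - e) * (l * (norm v)\<^sup>2) + e * 1))"
  proof -
    have "min ((norm v)\<^sup>2) (norm v) = (norm v)\<^sup>2"
      using assms(5) by (simp add: v_def min_def power2_eq_square mult_left_le)
    then have "\<theta> * (c * (norm v)\<^sup>2) \<le> \<theta> * pull v"
      using c[of v] \<open>0 < \<theta>\<close> by (intro mult_left_mono) auto
    moreover have "\<theta> * (\<theta> * (norm v)\<^sup>2) \<le> \<theta> * (c * (norm v)\<^sup>2)"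
      using \<open>0 < \<theta>\<close> assms(4) by (intro mult_left_mono mult_right_mono) (auto simp: \<theta>_def)
    moreover have "l' * (1 - c * t) * (norm v)\<^sup>2 \<le> l * (1 - e) * (norm v)\<^sup>2"
      using growth by (intro mult_right_mono) auto
    ultimately have "l' * (norm v)\<^sup>2 - \<theta> * pull v + \<theta>\<^sup>2 * (norm v)\<^sup>2 / 2 \<le> (1 - e) * (l * (norm v)\<^sup>2)"
      by (simp add: \<theta>_def power2_eq_square algebra_simps)
    with noise show ?thesis by simp
  qed
  also have "\<dots> \<le> ennreal ((1 - e) * exp (l * (norm v)\<^sup>2) + e * exp 1)"
    using convex_onD[OF convex_on_exp[of 1], of e "l * (norm v)\<^sup>2" 1] e by (intro ennreal_leI) simp
  finally show ?thesis by (simp add: v_def)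
qed

end

section \<open>The recursion and its past\<close>

locale median_recursion = M: prob_space M + law: median_law P m
  for M :: "'a measure"
    and P :: "'h::{real_inner, complete_space, second_countable_topology} measure" and m :: 'h +
  fixes Xs Z :: "nat \<Rightarrow> 'a \<Rightarrow> 'h" and \<gamma> :: "nat \<Rightarrow> real"
  assumes indep: "M.indep_vars (\<lambda>_. borel) Xs {1..}"
    and distr_Xs: "1 \<le> n \<Longrightarrow> distr M borel (Xs n) = P"
    and Z_1: "Z 1 \<in> borel_measurable (vimage_algebra (space M) (Xs 1) borel)"
    and Z_1_bounded: "bounded (Z 1 ` space M)"
    and Z_Suc: "1 \<le> n \<Longrightarrow> \<omega> \<in> space M \<Longrightarrow> Z (Suc n) \<omega> = Z n \<omega> + \<gamma> n *\<^sub>R sgn (Xs (Suc n) \<omega> - Z n \<omega>)"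
begin

text \<open>The \<open>\<sigma>\<close>-algebra generated by the first \<open>n\<close> observations. Working with \<open>\<sigma>\<close>-algebras avoids
  having to write \<open>Z 1\<close> as a function of \<open>Xs 1\<close>.\<close>

definition past :: "nat \<Rightarrow> 'a measure" where
  "past n = sigma (space M) (\<Union>i\<in>{1..n}. {Xs i -` A \<inter> space M |A. A \<in> sets borel})"

lemma space_past [simp]: "space (past n) = space M"
  unfolding past_def by (rule space_measure_of) auto

lemma sets_past: "sets (past n) = sigma_sets (space M) (\<Union>i\<in>{1..n}. {Xs i -` A \<inter> space M |A. A \<in> sets borel})"
  unfolding past_def by (rule sets_measure_of) auto

lemma Xs_past: "1 \<le> i \<Longrightarrow> i \<le> n \<Longrightarrow> Xs i \<in> borel_measurable (past n)"
proof (rule measurableI)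
  fix A :: "'h set" assume "1 \<le> i" "i \<le> n" "A \<in> sets borel"
  then have "Xs i -` A \<inter> space M \<in> (\<Union>i\<in>{1..n}. {Xs i -` A \<inter> space M |A. A \<in> sets borel})"
    by (intro UN_I[of i]) auto
  then show "Xs i -` A \<inter> space (past n) \<in> sets (past n)"
    unfolding sets_past space_past by (rule sigma_sets.Basic)
qed simp

lemma past_mono:
  assumes "i \<le> n" "f \<in> measurable (past i) N"
  shows "f \<in> measurable (past n) N"
proof -
  have "sets (past i) \<subseteq> sets (past n)"
    unfolding sets_past using assms(1) by (intro sigma_sets_mono' UN_mono) auto
  then show ?thesis using assms(2) unfolding measurable_def by auto
qed

lemma Z_past: "1 \<le> n \<Longrightarrow> Z n \<in> borel_measurable (past n)"
proof (induction n rule: dec_induct)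
  case base
  have "sets (vimage_algebra (space M) (Xs 1) (borel :: 'h measure)) \<subseteq> sets (past 1)"
  proof
    fix B assume "B \<in> sets (vimage_algebra (space M) (Xs 1) (borel :: 'h measure))"
    then obtain A :: "'h set" where "A \<in> sets borel" "B = Xs 1 -` A \<inter> space M"
      by (subst (asm) sets_vimage_algebra2) auto
    then show "B \<in> sets (past 1)"
      using measurable_sets[OF Xs_past[of 1 1], of A] by simp
  qed
  then show ?case using Z_1 unfolding measurable_def by auto
next
  case (step n)
  have [measurable]: "Z n \<in> borel_measurable (past (Suc n))" "Xs (Suc n) \<in> borel_measurable (past (Suc n))"
    using past_mono[OF _ step.IH, of "Suc n"] Xs_past[of "Suc n" "Suc n"] by simp_all
  have "(\<lambda>\<omega>. Z n \<omega> + \<gamma> n *\<^sub>R sgn (Xs (Suc n) \<omega> - Z n \<omega>)) \<in> borel_measurable (past (Suc n))"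
    by measurable
  then show ?case
    using step Z_Suc by (subst measurable_cong[where g = "\<lambda>\<omega>. Z n \<omega> + \<gamma> n *\<^sub>R sgn (Xs (Suc n) \<omega> - Z n \<omega>)"]) auto
qed

lemma Xs_measurable: "1 \<le> n \<Longrightarrow> Xs n \<in> borel_measurable M"
  using indep unfolding M.indep_vars_def by auto

lemma past_measurable: "f \<in> measurable (past n) N \<Longrightarrow> f \<in> measurable M N"
proof -
  have "sets (past n) \<subseteq> sets M"
    unfolding sets_past
    by (intro sets.sigma_sets_subset) (auto intro!: measurable_sets[OF Xs_measurable])
  then show "f \<in> measurable (past n) N \<Longrightarrow> f \<in> measurable M N"
    unfolding measurable_def by auto
qed

text \<open>The function \<open>g\<close> is there because \<open>indep_var\<close> relates variables of the same type only: it
  allows the new observation to be embedded into the type of \<open>S\<close>.\<close>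

lemma past_indep:
  assumes "S \<in> measurable (past n) N" "g \<in> measurable borel N'" "1 \<le> n"
  shows "M.indep_var N S N' (\<lambda>\<omega>. g (Xs (Suc n) \<omega>))"
proof -
  let ?E = "\<lambda>i. {Xs i -` A \<inter> space M |A. A \<in> sets borel}"
  have "M.indep_sets (\<lambda>b. sigma_sets (space M) (\<Union>i\<in>case_bool {1..n} {Suc n} b. ?E i)) UNIV"
  proof (rule M.indep_sets_collect_sigma)
    have "M.indep_sets ?E {1..}"
      using indep unfolding M.indep_vars_def2 by auto
    then show "M.indep_sets ?E (\<Union>b\<in>UNIV. case_bool {1..n} {Suc n} b)"
      by (rule M.indep_sets_mono_index[rotated]) (auto split: bool.splits)
    show "Int_stable (?E i)" for i
      unfolding Int_stable_def by (auto, rule_tac x = "A \<inter> Aa" in exI, auto)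
    show "disjoint_family (case_bool {1..n} {Suc n})"
      by (auto simp: disjoint_family_on_def split: bool.splits)
  qed
  then have "M.indep_sets (case_bool (sigma_sets (space M) {S -` A \<inter> space M |A. A \<in> sets N})
      (sigma_sets (space M) {(\<lambda>\<omega>. g (Xs (Suc n) \<omega>)) -` A \<inter> space M |A. A \<in> sets N'})) UNIV"
  proof (rule M.indep_sets_mono_sets)
    have "sigma_sets (space M) {S -` A \<inter> space M |A. A \<in> sets N} \<subseteq> sets (past n)"
      using sets.sigma_sets_subset[of "{S -` A \<inter> space M |A. A \<in> sets N}" "past n"]
        measurable_sets[OF assms(1)] by auto
    moreover have "{(\<lambda>\<omega>. g (Xs (Suc n) \<omega>)) -` A \<inter> space M |A. A \<in> sets N'} \<subseteq> ?E (Suc n)"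
    proof (safe)
      fix A assume "A \<in> sets N'"
      then have "g -` A \<in> sets borel" using measurable_sets[OF assms(2), of A] by simp
      moreover have "(\<lambda>\<omega>. g (Xs (Suc n) \<omega>)) -` A \<inter> space M = Xs (Suc n) -` (g -` A) \<inter> space M"
        by auto
      ultimately show "\<exists>B. (\<lambda>\<omega>. g (Xs (Suc n) \<omega>)) -` A \<inter> space M = Xs (Suc n) -` B \<inter> space M \<and> B \<in> sets borel"
        by blast
    qed
    then have "sigma_sets (space M) {(\<lambda>\<omega>. g (Xs (Suc n) \<omega>)) -` A \<inter> space M |A. A \<in> sets N'}
        \<subseteq> sigma_sets (space M) (?E (Suc n))"
      by (rule sigma_sets_mono')
    ultimately show "case_bool (sigma_sets (space M) {S -` A \<inter> space M |A. A \<in> sets N})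
        (sigma_sets (space M) {(\<lambda>\<omega>. g (Xs (Suc n) \<omega>)) -` A \<inter> space M |A. A \<in> sets N'}) b
      \<subseteq> sigma_sets (space M) (\<Union>i\<in>case_bool {1..n} {Suc n} b. ?E i)" for b
      unfolding sets_past by (cases b) auto
  qed
  then show ?thesis
    unfolding M.indep_var_eq M.indep_set_def
    using past_measurable[OF assms(1)] measurable_compose[OF Xs_measurable[of "Suc n"] assms(2)] by auto
qed

text \<open>Conditioning on the past, in the form of Fubini's theorem: the new observation may be integrated out
  with everything known at time \<open>n\<close> held fixed.\<close>

lemma nn_integral_past:
  fixes W :: "'a \<Rightarrow> ennreal" and T :: "'a \<Rightarrow> 'h" and f :: "'h \<Rightarrow> 'h \<Rightarrow> ennreal"
  assumes "W \<in> borel_measurable (past n)" "T \<in> borel_measurable (past n)" "1 \<le> n"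
    and f: "(\<lambda>(z, x). f z x) \<in> borel_measurable (borel \<Otimes>\<^sub>M borel)"
  shows "(\<integral>\<^sup>+\<omega>. W \<omega> * f (T \<omega>) (Xs (Suc n) \<omega>) \<partial>M) = (\<integral>\<^sup>+\<omega>. W \<omega> * (\<integral>\<^sup>+x. f (T \<omega>) x \<partial>P) \<partial>M)"
proof -
  let ?N = "borel \<Otimes>\<^sub>M borel :: (ennreal \<times> 'h) measure"
  define S where "S \<omega> = (W \<omega>, T \<omega>)" for \<omega>
  \<comment> \<open>Padding with \<open>0\<close> gives the observation the type of \<open>S\<close>, as \<open>indep_var\<close> requires.\<close>
  define g where "g x = (0 :: ennreal, x)" for x :: 'h
  define h where "h s y = fst s * f (snd s) (snd y)" for s y :: "ennreal \<times> 'h"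
  note [measurable] = f
  have S_past: "S \<in> measurable (past n) ?N"
    unfolding S_def using assms(1,2) by measurable
  have [measurable]: "S \<in> measurable M ?N" "Xs (Suc n) \<in> borel_measurable M"
    using past_measurable[OF S_past] Xs_measurable[of "Suc n"] by auto
  have g [measurable]: "g \<in> measurable borel ?N"
    unfolding g_def by measurable
  have gX [measurable]: "(\<lambda>\<omega>. g (Xs (Suc n) \<omega>)) \<in> measurable M ?N"
    by measurable
  have gP: "g \<in> measurable P ?N"
    using g by (simp add: measurable_cong_sets[OF law.sets_P refl])
  have h [measurable]: "(\<lambda>(s, y). h s y) \<in> borel_measurable (?N \<Otimes>\<^sub>M ?N)"
    unfolding h_def by measurable
  have P: "distr M borel (Xs (Suc n)) = P" by (rule distr_Xs) simp
  have Q: "distr M ?N (\<lambda>\<omega>. g (Xs (Suc n) \<omega>)) = distr P ?N g"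
    unfolding P[symmetric] by (subst distr_distr) (auto simp: comp_def)
  interpret Q: prob_space "distr P ?N g"
    by (rule law.prob_space_distr) (rule gP)
  have eq: "distr M ?N S \<Otimes>\<^sub>M distr P ?N g = distr M (?N \<Otimes>\<^sub>M ?N) (\<lambda>\<omega>. (S \<omega>, g (Xs (Suc n) \<omega>)))"
    using past_indep[OF S_past g assms(3)] unfolding M.indep_var_distribution_eq Q by simp
  have "(\<integral>\<^sup>+\<omega>. W \<omega> * f (T \<omega>) (Xs (Suc n) \<omega>) \<partial>M) = (\<integral>\<^sup>+\<omega>. (\<lambda>(s, y). h s y) (S \<omega>, g (Xs (Suc n) \<omega>)) \<partial>M)"
    by (simp add: h_def S_def g_def)
  also have "\<dots> = (\<integral>\<^sup>+p. (\<lambda>(s, y). h s y) p \<partial>distr M (?N \<Otimes>\<^sub>M ?N) (\<lambda>\<omega>. (S \<omega>, g (Xs (Suc n) \<omega>))))"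
    by (rule nn_integral_distr[symmetric]) measurable
  also have "\<dots> = (\<integral>\<^sup>+s. \<integral>\<^sup>+y. h s y \<partial>distr P ?N g \<partial>distr M ?N S)"
    unfolding eq[symmetric]
    by (subst Q.nn_integral_fst[symmetric]) auto
  also have "\<dots> = (\<integral>\<^sup>+\<omega>. \<integral>\<^sup>+y. h (S \<omega>) y \<partial>distr P ?N g \<partial>M)"
  proof (rule nn_integral_distr)
    have "(\<lambda>s. \<integral>\<^sup>+y. h s y \<partial>distr P ?N g) \<in> borel_measurable ?N"
      by (rule Q.borel_measurable_nn_integral) simp
    then show "(\<lambda>s. \<integral>\<^sup>+y. h s y \<partial>distr P ?N g) \<in> borel_measurable (distr M ?N S)"
      by simp
  qed measurable
  also have "\<dots> = (\<integral>\<^sup>+\<omega>. W \<omega> * (\<integral>\<^sup>+x. f (T \<omega>) x \<partial>P) \<partial>M)"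
  proof (rule nn_integral_cong)
    fix \<omega>
    have "(\<lambda>x. f (T \<omega>) x) \<in> borel_measurable P"
      using f by (auto simp: measurable_cong_sets[OF law.sets_P refl])
    then show "(\<integral>\<^sup>+y. h (S \<omega>) y \<partial>distr P ?N g) = W \<omega> * (\<integral>\<^sup>+x. f (T \<omega>) x \<partial>P)"
      by (subst nn_integral_distr[OF gP]) (auto simp: h_def S_def g_def nn_integral_cmult)
  qed
  finally show ?thesis .
qed

end

section \<open>Polynomial step sizes and contracting recursions\<close>

text \<open>Summed over \<open>n\<close>, this bounds the total length of the first \<open>n\<close> steps by a multiple of \<open>n\<close> to the
  power \<open>1 - a\<close>.\<close>

lemma powr_increment_ge:
  assumes "0 < a" "a < 1" "1 \<le> n"
  shows "(1 - a) / 2 * real n powr (- a) \<le> real (Suc n) powr (1 - a) - real n powr (1 - a)"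
proof -
  define x where "x = real n / real (Suc n)"
  have x: "0 < x" using assms by (simp add: x_def)
  have n: "0 < real n" using assms by simp
  have "x powr (1 - a) \<le> 1 + (1 - a) * (x - 1)"
  proof -
    have "x powr (1 - a) = exp (1 * ((1 - a) *\<^sub>R ln x + a *\<^sub>R 0))"
      using x by (simp add: powr_def)
    also have "\<dots> \<le> (1 - a) * exp (1 * ln x) + a * exp (1 * 0)"
      by (rule convex_onD[OF convex_on_exp[of 1]]) (use assms in auto)
    also have "\<dots> = (1 - a) * x + a"
      using x by simp
    finally show ?thesis by (simp add: algebra_simps)
  qed
  then have "real (Suc n) powr (1 - a) * x powr (1 - a) \<le> real (Suc n) powr (1 - a) * (1 + (1 - a) * (x - 1))"
    by (intro mult_left_mono) auto
  also have "real (Suc n) powr (1 - a) * x powr (1 - a) = real n powr (1 - a)"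
    using x n by (subst powr_mult[symmetric]) (auto simp: x_def)
  also have "1 + (1 - a) * (x - 1) = 1 - (1 - a) / real (Suc n)"
    by (simp add: x_def field_simps)
  finally have 1: "real n powr (1 - a) \<le> real (Suc n) powr (1 - a) - (1 - a) * (real (Suc n) powr (1 - a) / real (Suc n))"
    by (simp add: algebra_simps)
  have 2: "real (Suc n) powr (1 - a) / real (Suc n) = real (Suc n) powr (- a)"
    by (simp add: powr_diff powr_minus_divide del: of_nat_Suc)
  have "real n powr (- a) \<le> 2 * real (Suc n) powr (- a)"
  proof -
    have "real (Suc n) powr a \<le> (2 * real n) powr a"
      using assms by (intro powr_mono2) auto
    also have "\<dots> \<le> 2 * real n powr a"
      using assms powr_mono[of a 1 2] by (simp add: powr_mult)
    finally show ?thesis using n by (simp add: powr_minus field_simps)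
  qed
  then have "(1 - a) / 2 * real n powr (- a) \<le> (1 - a) * real (Suc n) powr (- a)"
    using assms mult_left_mono[of "real n powr (- a)" "2 * real (Suc n) powr (- a)" "(1 - a) / 2"] by simp
  also have "\<dots> \<le> real (Suc n) powr (1 - a) - real n powr (1 - a)"
    using 1 unfolding 2 by linarith
  finally show ?thesis .
qed

text \<open>The parameter \<open>5 ln n\<close> increases by about \<open>5 / n\<close> and is multiplied by a distance that may be as
  large as \<open>n\<close> to the power \<open>1 - a\<close>. The result has the order \<open>n\<close> to the power \<open>- a\<close> of the step size, and
  the unbounded logarithm on the right makes it negligible whatever the constants are.\<close>

lemma log_growth_dominated:
  assumes "0 < a" "a < 1" "0 < k" 
  shows "eventually (\<lambda>n. (5 * ln (real (Suc n)) - 5 * ln (real n)) * (R + B * real n powr (1 - a))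
     \<le> 5 * ln (real (Suc n)) * (k * real n powr (- a))) sequentially"
  using assms by real_asymp

lemma log_times_step_le: 
  assumes "0 < a" "a < 1" "0 < c" 
  shows "eventually (\<lambda>n. 5 * ln (real (Suc n)) * (k * real n powr (- a)) \<le> c) sequentially"
  using assms by real_asymp

lemma inverse_step_growth: 
  assumes "0 < a" "a < 1" "0 < c" 
  shows "eventually (\<lambda>n. real (Suc n) powr a * (1 - c * (real n powr (- a))) \<le> real n powr a * (1 - c * real n powr (- a) / 2)) sequentially"
  using assms by real_asymp

lemma summable_log_times_step_squared: 
  assumes "1/2 < a" "a < 1" "0 < k"
  shows "summable (\<lambda>n. 5 * ln (real (Suc n)) * (k * real n powr (- a))\<^sup>2)"
proof (rule summable_comparison_test_bigo)
  show "summable (\<lambda>n. norm (real n powr (- (a + 1 / 2))))"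
    using assms by (simp add: summable_real_powr_iff)
  show "(\<lambda>n. 5 * ln (real (Suc n)) * (k * real n powr (- a))\<^sup>2) \<in> O(\<lambda>n. real n powr (- (a + 1 / 2)))"
    using assms by real_asymp
qed

text \<open>The distance of \<open>a n\<close> above the fixed point \<open>b\<close> shrinks by the product of the \<open>1 - e n\<close>, which tends
  to \<open>0\<close> because the sum of the \<open>e n\<close> diverges.\<close>

lemma contraction_limit:
  fixes a :: "nat \<Rightarrow> ennreal" and e :: "nat \<Rightarrow> real"
  assumes "a N < \<infinity>" and rec: "\<And>n. N \<le> n \<Longrightarrow> a (Suc n) \<le> ennreal (1 - e n) * a n + ennreal (e n * b)"
    and e: "\<And>n. N \<le> n \<Longrightarrow> 0 \<le> e n" "\<And>n. N \<le> n \<Longrightarrow> e n \<le> 1"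
    and div: "\<not> summable e" and "0 \<le> b" "0 < \<eta>"
  shows "eventually (\<lambda>n. a n \<le> ennreal (b + \<eta>)) sequentially"
proof -
  \<comment> \<open>The summand \<open>1\<close> makes \<open>A\<close> positive, so that it can be divided by.\<close>
  define A where "A = enn2real (a N) + 1"
  have A: "0 < A" "a N \<le> ennreal A"
    using assms(1) by (auto simp: A_def add_nonneg_pos less_top[symmetric] ennreal_enn2real_if ennreal_leI)
  define q where "q n = (\<Prod>j\<in>{N..<n}. 1 - e j)" for n
  have q0: "0 \<le> q n" for n unfolding q_def using e by (intro prod_nonneg) auto
  have bound: "a n \<le> ennreal (b + A * q n)" if "N \<le> n" for n
    using that
  proof (induction n rule: dec_induct)
    case base
    have "a N \<le> ennreal A" by (rule A)
    also have "\<dots> \<le> ennreal (b + A * q N)" using assms by (intro ennreal_leI) (simp add: q_def)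
    finally show ?case .
  next
    case (step n)
    have "a (Suc n) \<le> ennreal (1 - e n) * a n + ennreal (e n * b)" by (rule rec) fact
    also have "\<dots> \<le> ennreal (1 - e n) * ennreal (b + A * q n) + ennreal (e n * b)"
      by (intro add_mono mult_left_mono step) auto
    also have "\<dots> = ennreal ((1 - e n) * (b + A * q n) + e n * b)"
      using e[OF step(1)] q0[of n] A assms
      by (simp add: ennreal_mult[symmetric] ennreal_plus[symmetric] del: ennreal_plus)
    also have "(1 - e n) * (b + A * q n) + e n * b = b + A * q (Suc n)"
      using step(1) by (simp add: q_def algebra_simps)
    finally show ?case .
  qed
  have "\<exists>n0\<ge>N. A * exp (- (\<Sum>j\<in>{N..<n0}. e j)) < \<eta>"
  proof -
    obtain n1 where n1: "ln (A / \<eta>) + 1 < (\<Sum>j\<le>n1. e (j + N))"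
    proof (rule ccontr)
      assume "\<not> thesis"
      then have le: "(\<Sum>j\<le>n. e (j + N)) \<le> ln (A / \<eta>) + 1" for n
        using that not_less by blast
      have "summable (\<lambda>j. e (j + N))"
        by (rule bounded_imp_summable[OF _ le]) (simp add: e)
      then show False using div by simp
    qed
    have "(\<Sum>j\<in>{N..<Suc n1 + N}. e j) = (\<Sum>j\<le>n1. e (j + N))"
      using sum.shift_bounds_nat_ivl[of e 0 N "Suc n1"] by (simp add: lessThan_Suc_atMost atLeast0LessThan)
    then have "A * exp (- (\<Sum>j\<in>{N..<Suc n1 + N}. e j)) < A * exp (- ln (A / \<eta>))"
      using n1 A by simp
    also have "\<dots> = \<eta>" using A assms by (simp add: exp_minus)
    finally show ?thesis by (intro exI[of _ "Suc n1 + N"]) simp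
  qed
  then obtain n0 where n0: "N \<le> n0" "A * exp (- (\<Sum>j\<in>{N..<n0}. e j)) < \<eta>" by blast
  have "a n \<le> ennreal (b + \<eta>)" if "n0 \<le> n" for n
  proof -
    have "q n \<le> (\<Prod>j\<in>{N..<n}. exp (- e j))"
      unfolding q_def
    proof (rule prod_mono)
      fix j assume "j \<in> {N..<n}"
      then show "0 \<le> 1 - e j \<and> 1 - e j \<le> exp (- e j)"
        using e[of j] exp_ge_add_one_self[of "- e j"] by auto
    qed
    also have "\<dots> = exp (- (\<Sum>j\<in>{N..<n}. e j))" by (simp add: exp_sum sum_negf[symmetric])
    also have "\<dots> \<le> exp (- (\<Sum>j\<in>{N..<n0}. e j))"
    proof -
      have "(\<Sum>j\<in>{N..<n0}. e j) \<le> (\<Sum>j\<in>{N..<n}. e j)"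
        using that e by (intro sum_mono2) auto
      then show ?thesis by simp
    qed
    finally have "A * q n \<le> A * exp (- (\<Sum>j\<in>{N..<n0}. e j))" using A by simp
    then have "b + A * q n \<le> b + \<eta>" using n0 by simp
    then show ?thesis using bound[of n] n0 that ennreal_leI order_trans by (meson le_trans)
  qed
  then show ?thesis unfolding eventually_sequentially by blast
qed

section \<open>Localization in the unit ball\<close>

locale median_recursion_powr = median_recursion +
  fixes a k c :: real
  assumes a: "1 / 2 < a" "a < 1" and k: "0 < k" and c: "0 < c"
    and step_eq: "1 \<le> n \<Longrightarrow> \<gamma> n = k * real n powr (- a)"
    and coercive: "c * min ((norm v)\<^sup>2) (norm v) \<le> law.pull v"
begin

lemma step_pos: "1 \<le> n \<Longrightarrow> 0 < \<gamma> n"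
  using k by (simp add: step_eq)

lemma Z_measurable: "1 \<le> n \<Longrightarrow> Z n \<in> borel_measurable M"
  using Z_past past_measurable by blast

lemma norm_Z_le:
  obtains R B where "1 \<le> R" "0 \<le> B" "\<And>n \<omega>. 1 \<le> n \<Longrightarrow> \<omega> \<in> space M \<Longrightarrow> norm (Z n \<omega> - m) \<le> R + B * real n powr (1 - a)"
proof -
  obtain b where b: "\<And>\<omega>. \<omega> \<in> space M \<Longrightarrow> norm (Z 1 \<omega>) \<le> b"
    using Z_1_bounded unfolding bounded_iff by blast
  define R where "R = max 1 (b + norm m)"
  define B where "B = 2 * k / (1 - a)"
  have "norm (Z n \<omega> - m) \<le> R + B * real n powr (1 - a)" if "1 \<le> n" "\<omega> \<in> space M" for n \<omega>
    using that(1)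
  proof (induction n rule: dec_induct)
    case base
    have "norm (Z 1 \<omega> - m) \<le> b + norm m"
      using b[OF that(2)] norm_triangle_ineq4[of "Z 1 \<omega>" m] by simp
    moreover have "0 \<le> B" using a k by (simp add: B_def)
    ultimately show ?case by (simp add: R_def)
  next
    case (step n)
    have "norm (Z (Suc n) \<omega> - m) = norm ((Z n \<omega> - m) + \<gamma> n *\<^sub>R sgn (Xs (Suc n) \<omega> - Z n \<omega>))"
      using Z_Suc[OF step(1) that(2)] by (simp add: algebra_simps)
    also have "\<dots> \<le> norm (Z n \<omega> - m) + \<gamma> n * 1"
      using step_pos[OF step(1)]
      by (intro norm_triangle_le add_left_mono) (simp add: norm_sgn)
    also have "\<dots> \<le> R + B * real n powr (1 - a) + B * ((1 - a) / 2 * real n powr (- a))"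
      using step a by (simp add: step_eq B_def)
    also have "\<dots> \<le> R + B * real n powr (1 - a) + B * (real (Suc n) powr (1 - a) - real n powr (1 - a))"
      using powr_increment_ge[of a n] a step k by (intro add_left_mono mult_left_mono) (auto simp: B_def)
    finally show ?case by (simp add: algebra_simps)
  qed
  moreover have "1 \<le> R" "0 \<le> B" using a k by (auto simp: R_def B_def)
  ultimately show ?thesis using that by blast
qed

lemma nn_integral_finite_of_bounded:
  assumes "\<And>\<omega>. \<omega> \<in> space M \<Longrightarrow> g \<omega> \<le> ennreal b"
  shows "(\<integral>\<^sup>+\<omega>. g \<omega> \<partial>M) < \<infinity>"
proof -
  have "(\<integral>\<^sup>+\<omega>. g \<omega> \<partial>M) \<le> (\<integral>\<^sup>+\<omega>. ennreal b \<partial>M)"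
    by (rule nn_integral_mono) (rule assms)
  also have "\<dots> = ennreal b" by (simp add: M.emeasure_space_1)
  finally show ?thesis by (simp add: le_less_trans)
qed

text \<open>The exponential moments of \<open>5 ln n\<close> times the potential grow by factors \<open>exp (s n)\<close> with summable
  \<open>s\<close>, so they are bounded, and Markov's inequality applies.\<close>

lemma tail_bound:
  obtains K N where "1 \<le> N"
    "\<And>n. N \<le> n \<Longrightarrow> M.prob {\<omega> \<in> space M. 1 < norm (Z n \<omega> - m)} \<le> K * (1 / real n ^ 2)"
proof -
  define l where "l n = 5 * ln (real n)" for n :: nat
  define s where "s n = l (Suc n) * (k * real n powr (- a))\<^sup>2" for n
  define E where "E n = (\<integral>\<^sup>+\<omega>. ennreal (exp (l n * pot (Z n \<omega> - m))) \<partial>M)" for n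
  obtain R B where R: "1 \<le> R" "0 \<le> B" and
    B: "\<And>n \<omega>. 1 \<le> n \<Longrightarrow> \<omega> \<in> space M \<Longrightarrow> norm (Z n \<omega> - m) \<le> R + B * real n powr (1 - a)"
    by (rule norm_Z_le) (rule that, assumption+)
  have "eventually (\<lambda>n. 1 \<le> n \<and> l (Suc n) * \<gamma> n \<le> c \<and>
      (l (Suc n) - l n) * (R + B * real n powr (1 - a)) \<le> l (Suc n) * \<gamma> n * (c / 4)) sequentially"
    using log_times_step_le[of a c k] log_growth_dominated[of a "k * (c / 4)" R B] eventually_ge_at_top[of 1] a c k
    by (auto elim!: eventually_elim2 simp: l_def step_eq mult_ac eventually_conj_iff cong: conj_cong)
  then obtain N where N: "\<And>n. N \<le> n \<Longrightarrow> 1 \<le> n \<and> l (Suc n) * \<gamma> n \<le> c \<and>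
      (l (Suc n) - l n) * (R + B * real n powr (1 - a)) \<le> l (Suc n) * \<gamma> n * (c / 4)"
    unfolding eventually_sequentially by blast
  have "1 \<le> N" using N[of N] by simp
  have step: "E (Suc n) \<le> ennreal (exp (s n)) * E n" if "N \<le> n" for n
  proof -
    have n: "1 \<le> n" using N[OF that] by simp
    have l: "0 < l (Suc n)" "0 \<le> l n" "l n \<le> l (Suc n)" using n by (auto simp: l_def)
    have g: "0 < \<gamma> n" using step_pos[OF n] .
    note [measurable] = Z_measurable[OF n]
    let ?f = "\<lambda>z x. ennreal (exp (l (Suc n) * pot (z + \<gamma> n *\<^sub>R sgn (x - z) - m)))"
    have "E (Suc n) = (\<integral>\<^sup>+\<omega>. 1 * ?f (Z n \<omega>) (Xs (Suc n) \<omega>) \<partial>M)"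
      unfolding E_def by (intro nn_integral_cong) (simp add: Z_Suc[OF n])
    also have "\<dots> = (\<integral>\<^sup>+\<omega>. 1 * (\<integral>\<^sup>+x. ?f (Z n \<omega>) x \<partial>P) \<partial>M)"
      by (rule nn_integral_past[OF _ Z_past n]) (use n in measurable)
    also have "\<dots> \<le> (\<integral>\<^sup>+\<omega>. ennreal (exp (s n)) * ennreal (exp (l n * pot (Z n \<omega> - m))) \<partial>M)"
    proof (rule nn_integral_mono)
      fix \<omega> assume \<omega>: "\<omega> \<in> space M"
      define p where "p = pot (Z n \<omega> - m)"
      have p: "0 \<le> p" "p \<le> R + B * real n powr (1 - a)"
        using pot_nonneg[of "Z n \<omega> - m"] pot_le_norm[of "Z n \<omega> - m"] B[OF n \<omega>] by (auto simp: p_def)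
      have big: "(l (Suc n) - l n) * b \<le> l (Suc n) * \<gamma> n * (c / 4)" if "b \<le> R + B * real n powr (1 - a)" for b
        using mult_left_mono[OF that, of "l (Suc n) - l n"] N[OF \<open>N \<le> n\<close>] l by auto
      \<comment> \<open>Far from \<open>m\<close> the deterministic bound on \<open>p\<close> is used; close to \<open>m\<close> both sides are linear
        in \<open>p\<close> and the same bound is used with \<open>1\<close> in place of \<open>p\<close>.\<close>
      have "(l (Suc n) - l n) * p \<le> l (Suc n) * \<gamma> n * (c / 2) * min p (1 / 2)"
      proof (cases "p \<le> 1 / 2")
        case True
        have "(l (Suc n) - l n) \<le> l (Suc n) * \<gamma> n * (c / 4)"
          using big[of 1] R by (simp add: add_increasing2)
        also have "\<dots> \<le> l (Suc n) * \<gamma> n * (c / 2)"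
          using l g c by (intro mult_left_mono) auto
        finally have "(l (Suc n) - l n) * p \<le> l (Suc n) * \<gamma> n * (c / 2) * p"
          using p by (intro mult_right_mono)
        then show ?thesis using True by (simp add: min_def)
      next
        case False
        then show ?thesis using big[OF p(2)] by (simp add: min_def)
      qed
      then have "(\<integral>\<^sup>+x. ?f (Z n \<omega>) x \<partial>P) \<le> ennreal (exp (l n * pot (Z n \<omega> - m) + l (Suc n) * (\<gamma> n)\<^sup>2 / 2))"
        unfolding p_def using N[OF \<open>N \<le> n\<close>] g l by (intro law.exp_pot_step[OF coercive]) auto
      also have "\<dots> \<le> ennreal (exp (s n + l n * pot (Z n \<omega> - m)))"
        using l n by (intro ennreal_leI) (simp add: s_def step_eq)
      finally show "1 * (\<integral>\<^sup>+x. ?f (Z n \<omega>) x \<partial>P) \<le> ennreal (exp (s n)) * ennreal (exp (l n * pot (Z n \<omega> - m)))"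
        by (simp add: exp_add ennreal_mult')
    qed
    also have "\<dots> = ennreal (exp (s n)) * E n"
      unfolding E_def by (rule nn_integral_cmult) measurable
    finally show ?thesis .
  qed
  have "summable s"
    unfolding s_def l_def using summable_log_times_step_squared[OF a k] by simp
  define K where "K = enn2real (E N) * exp (suminf s)"
  have EN: "E N < \<infinity>"
    unfolding E_def
  proof (rule nn_integral_finite_of_bounded)
    fix \<omega> assume "\<omega> \<in> space M"
    then have "pot (Z N \<omega> - m) \<le> R + B * real N powr (1 - a)"
      using B[OF \<open>1 \<le> N\<close>] pot_le_norm[of "Z N \<omega> - m"] by fastforce
    moreover have "0 \<le> l N" using \<open>1 \<le> N\<close> by (simp add: l_def)
    ultimately have "l N * pot (Z N \<omega> - m) \<le> l N * (R + B * real N powr (1 - a))"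
      by (rule mult_left_mono)
    then show "ennreal (exp (l N * pot (Z N \<omega> - m))) \<le> ennreal (exp (l N * (R + B * real N powr (1 - a))))"
      by (intro ennreal_leI) simp
  qed
  have s0: "0 \<le> s n" for n by (cases "n = 0") (auto simp: s_def l_def)
  have EK: "E n \<le> ennreal K" if "N \<le> n" for n
  proof -
    have "E n \<le> E N * ennreal (exp (\<Sum>j\<in>{N..<n}. s j))"
      using that
    proof (induction n rule: dec_induct)
      case (step n)
      have "E (Suc n) \<le> ennreal (exp (s n)) * E n" by (rule \<open>\<And>n. N \<le> n \<Longrightarrow> E (Suc n) \<le> ennreal (exp (s n)) * E n\<close>) fact
      also have "\<dots> \<le> ennreal (exp (s n)) * (E N * ennreal (exp (\<Sum>j\<in>{N..<n}. s j)))"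
        by (intro mult_left_mono step) auto
      also have "\<dots> = E N * ennreal (exp (\<Sum>j\<in>{N..<Suc n}. s j))"
        using step(1) by (simp add: exp_add ennreal_mult' mult_ac)
      finally show ?case .
    qed simp
    also have "\<dots> \<le> E N * ennreal (exp (suminf s))"
      using sum_le_suminf[OF \<open>summable s\<close>, of "{N..<n}"] s0 by (intro mult_left_mono ennreal_leI) auto
    also have "\<dots> = ennreal K"
      using EN by (simp add: K_def ennreal_mult less_top[symmetric] ennreal_enn2real_if)
    finally show ?thesis .
  qed
  have "M.prob {\<omega> \<in> space M. 1 < norm (Z n \<omega> - m)} \<le> K * (1 / real n ^ 2)" if "N \<le> n" for n
  proof -
    have n: "1 \<le> n" using N[OF that] by simp
    note [measurable] = Z_measurable[OF n]
    let ?A = "{\<omega> \<in> space M. 1 < norm (Z n \<omega> - m)}"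
    have "emeasure M ?A = (\<integral>\<^sup>+\<omega>. indicator ?A \<omega> \<partial>M)"
      by (subst nn_integral_indicator) measurable
    also have "\<dots> \<le> (\<integral>\<^sup>+\<omega>. ennreal (1 / real n ^ 2) * ennreal (exp (l n * pot (Z n \<omega> - m))) \<partial>M)"
    proof (rule nn_integral_mono)
      fix \<omega>
      have "1 \<le> 1 / real n ^ 2 * exp (l n * pot (Z n \<omega> - m))" if "1 < norm (Z n \<omega> - m)"
      proof -
        have "real n ^ 2 = exp (l n * (2 / 5))"
          using n by (simp add: l_def exp_of_nat_mult[of 2, simplified] power2_eq_square exp_add[symmetric] mult_exp_exp) 
        also have "\<dots> \<le> exp (l n * pot (Z n \<omega> - m))"
          using mult_left_mono[OF less_imp_le[OF pot_gt[OF that]], of "l n"] n by (simp add: l_def)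
        finally show ?thesis using n by (simp add: field_simps)
      qed
      then show "indicator ?A \<omega> \<le> ennreal (1 / real n ^ 2) * ennreal (exp (l n * pot (Z n \<omega> - m)))"
        by (auto simp: indicator_def ennreal_mult'[symmetric] ennreal_1[symmetric] simp del: ennreal_1)
    qed
    also have "\<dots> = ennreal (1 / real n ^ 2) * E n"
      unfolding E_def by (rule nn_integral_cmult) measurable
    also have "\<dots> \<le> ennreal (1 / real n ^ 2) * ennreal K"
      by (intro mult_left_mono EK that) auto
    also have "\<dots> = ennreal (K * (1 / real n ^ 2))"
      by (simp add: ennreal_mult'[symmetric] K_def)
    finally show ?thesis
      by (simp add: M.emeasure_eq_measure K_def)
  qed
  then show ?thesis using that \<open>1 \<le> N\<close> by blast
qed

lemma exceeds_from:
  "(\<Union>i. {\<omega> \<in> space M. 1 < norm (Z (i + L) \<omega> - m)}) = {\<omega> \<in> space M. \<exists>n\<ge>L. 1 < norm (Z n \<omega> - m)}"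
proof (intro set_eqI iffI)
  fix \<omega> assume "\<omega> \<in> {\<omega> \<in> space M. \<exists>n\<ge>L. 1 < norm (Z n \<omega> - m)}"
  then obtain n where "\<omega> \<in> space M" "L \<le> n" "1 < norm (Z n \<omega> - m)" by blast
  then show "\<omega> \<in> (\<Union>i. {\<omega> \<in> space M. 1 < norm (Z (i + L) \<omega> - m)})"
    by (intro UN_I[of "n - L"]) auto
qed (use le_add2 in blast)

lemma localization:
  assumes "0 < \<eta>"
  obtains N where "1 \<le> N" "M.prob {\<omega> \<in> space M. \<exists>n\<ge>N. 1 < norm (Z n \<omega> - m)} \<le> \<eta>"
proof -
  obtain K N where N: "1 \<le> N" and
    K: "\<And>n. N \<le> n \<Longrightarrow> M.prob {\<omega> \<in> space M. 1 < norm (Z n \<omega> - m)} \<le> K * (1 / real n ^ 2)"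
    by (rule tail_bound) (rule that, assumption+)
  have sm: "summable (\<lambda>n. K * (1 / real n ^ 2))"
    using inverse_power_summable[of 2, where ?'a = real] by (intro summable_mult) (simp add: inverse_eq_divide)
  obtain N' where N': "\<And>n. N' \<le> n \<Longrightarrow> norm (\<Sum>i. K * (1 / real (i + n) ^ 2)) < \<eta>"
    using suminf_exist_split[OF assms sm] by blast
  define L where "L = max N N'"
  have L: "1 \<le> L" "N \<le> L" "N' \<le> L" using N by (auto simp: L_def)
  let ?A = "\<lambda>i. {\<omega> \<in> space M. 1 < norm (Z (i + L) \<omega> - m)}"
  have meas: "?A i \<in> M.events" for i
  proof -
    have [measurable]: "Z (i + L) \<in> borel_measurable M" using Z_measurable L by simp
    show ?thesis by measurable
  qed
  have le: "M.prob (?A i) \<le> K * (1 / real (i + L) ^ 2)" for i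
    using L by (intro K) simp
  have sm': "summable (\<lambda>i. K * (1 / real (i + L) ^ 2))"
    using sm by (subst summable_iff_shift[of "\<lambda>i. K * (1 / real i ^ 2)" L])
  have sA: "summable (\<lambda>i. M.prob (?A i))"
    by (rule summable_comparison_test'[OF sm', of 0]) (use le in simp)
  have "{\<omega> \<in> space M. \<exists>n\<ge>L. 1 < norm (Z n \<omega> - m)} = (\<Union>i. ?A i)"
    by (rule exceeds_from[symmetric])
  then have "M.prob {\<omega> \<in> space M. \<exists>n\<ge>L. 1 < norm (Z n \<omega> - m)} \<le> (\<Sum>i. M.prob (?A i))"
    using M.finite_measure_subadditive_countably[OF _ sA] meas by auto
  also have "\<dots> \<le> (\<Sum>i. K * (1 / real (i + L) ^ 2))"
    by (rule suminf_le[OF le sA sm'])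
  also have "\<dots> \<le> \<eta>" using N'[OF L(3)] by simp
  finally show ?thesis using that L by blast
qed

section \<open>Exponential moments at the scale of the step size\<close>

text \<open>The parameter \<open>c / (4 \<gamma>\<^sub>n)\<close> is of the largest order that the noise allows, since
  \<open>exp_norm_step\<close> needs \<open>2 \<lambda>\<^sub>n\<^sub>+\<^sub>1 \<gamma>\<^sub>n \<le> c\<close>. The event restricts the positions strictly before time \<open>n\<close>,
  so at time \<open>n + 1\<close> it lies in the past of step \<open>n\<close>. The limiting bound does not depend on \<open>N\<close>, which
  is what keeps the constant in the confidence ball free of \<open>\<delta>\<close>.\<close>

lemma localized_exponential_moment:
  assumes "1 \<le> N"
  shows "eventually (\<lambda>n. (\<integral>\<^sup>+\<omega>. indicator {\<omega> \<in> space M. \<forall>j\<in>{N..<n}. norm (Z j \<omega> - m) \<le> 1} \<omega>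
      * ennreal (exp (c / (4 * \<gamma> n) * (norm (Z n \<omega> - m))\<^sup>2)) \<partial>M) \<le> ennreal (exp 1 + 1)) sequentially"
proof -
  define l where "l n = c / (4 * \<gamma> n)" for n
  define e where "e n = c * (k * real n powr (- a)) / 2" for n
  define I where "I n = {\<omega> \<in> space M. \<forall>j\<in>{N..<n}. norm (Z j \<omega> - m) \<le> 1}" for n
  define E where "E n = (\<integral>\<^sup>+\<omega>. indicator (I n) \<omega> * ennreal (exp (l n * (norm (Z n \<omega> - m))\<^sup>2)) \<partial>M)" for n
  have "eventually (\<lambda>n. e n \<le> 1) sequentially"
    unfolding e_def using a k by real_asymp
  moreover have "eventually (\<lambda>n. real (Suc n) powr a * (1 - c * k * (real n powr (- a))) \<le> real n powr a * (1 - c * k * real n powr (- a) / 2)) sequentially"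
    using a k c by (intro inverse_step_growth) auto
  ultimately have "eventually (\<lambda>n. N \<le> n \<and> e n \<le> 1 \<and> l (Suc n) * (1 - c * \<gamma> n) \<le> l n * (1 - e n)) sequentially"
    using eventually_ge_at_top[of N]
  proof eventually_elim
    case (elim n)
    then have n: "1 \<le> n" using assms by simp
    have "l (Suc n) = c / (4 * k) * real (Suc n) powr a" "l n = c / (4 * k) * real n powr a"
      using n by (auto simp: l_def step_eq powr_minus divide_simps)
    then show ?case
      using mult_left_mono[OF elim(2), of "c / (4 * k)"] c k elim n
      by (simp add: e_def step_eq mult_ac)
  qed
  then obtain N0 where N0: "\<And>n. N0 \<le> n \<Longrightarrow> N \<le> n \<and> e n \<le> 1 \<and> l (Suc n) * (1 - c * \<gamma> n) \<le> l n * (1 - e n)"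
    unfolding eventually_sequentially by blast
  have "1 \<le> N0" "N \<le> N0" using N0[of N0] assms by auto
  obtain R B where "1 \<le> R" "0 \<le> B" and
    B: "\<And>n \<omega>. 1 \<le> n \<Longrightarrow> \<omega> \<in> space M \<Longrightarrow> norm (Z n \<omega> - m) \<le> R + B * real n powr (1 - a)"
    by (rule norm_Z_le) (rule that, assumption+)
  have "eventually (\<lambda>n. E n \<le> ennreal (exp 1 + 1)) sequentially"
  proof (rule contraction_limit[where N = N0 and e = e])
    show "E N0 < \<infinity>"
      unfolding E_def
    proof (rule nn_integral_finite_of_bounded)
      fix \<omega> assume "\<omega> \<in> space M"
      then have "(norm (Z N0 \<omega> - m))\<^sup>2 \<le> (R + B * real N0 powr (1 - a))\<^sup>2"
        using B[OF \<open>1 \<le> N0\<close>] by (intro power_mono) auto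
      moreover have "0 \<le> l N0" using step_pos[OF \<open>1 \<le> N0\<close>] c by (simp add: l_def)
      ultimately have "l N0 * (norm (Z N0 \<omega> - m))\<^sup>2 \<le> l N0 * (R + B * real N0 powr (1 - a))\<^sup>2"
        by (rule mult_left_mono)
      then have "exp (l N0 * (norm (Z N0 \<omega> - m))\<^sup>2) \<le> exp (l N0 * (R + B * real N0 powr (1 - a))\<^sup>2)"
        by simp
      then show "indicator (I N0) \<omega> * ennreal (exp (l N0 * (norm (Z N0 \<omega> - m))\<^sup>2))
          \<le> ennreal (exp (l N0 * (R + B * real N0 powr (1 - a))\<^sup>2))"
        by (auto simp: indicator_def intro: ennreal_leI)
    qed
    show "E (Suc n) \<le> ennreal (1 - e n) * E n + ennreal (e n * exp 1)" if "N0 \<le> n" for n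
    proof -
      have n: "1 \<le> n" "N \<le> n" using N0[OF that] assms by auto
      have g: "0 < \<gamma> n" "0 < \<gamma> (Suc n)" using step_pos n by auto
      have l: "0 < l (Suc n)" using g c by (simp add: l_def)
      have ratio: "\<gamma> n \<le> 2 * \<gamma> (Suc n)"
      proof -
        have "real (Suc n) powr a \<le> (2 * real n) powr a"
          using n a by (intro powr_mono2) auto
        also have "\<dots> \<le> 2 * real n powr a"
          using a powr_mono[of a 1 2] mult_right_mono[of "2 powr a" 2 "real n powr a"] by (simp add: powr_mult)
        finally show ?thesis using n k by (simp add: step_eq powr_minus field_simps)
      qed
      have I [measurable]: "I (Suc n) \<in> sets (past n)"
      proof -
        have "{\<omega> \<in> space (past n). norm (Z j \<omega> - m) \<le> 1} \<in> sets (past n)" if "j \<in> {N..n}" for j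
        proof -
          have [measurable]: "Z j \<in> borel_measurable (past n)"
            using past_mono[OF _ Z_past[of j], of n] that assms by simp
          show ?thesis by measurable
        qed
        then have "{\<omega> \<in> space (past n). \<forall>j\<in>{N..n}. norm (Z j \<omega> - m) \<le> 1} \<in> sets (past n)"
          by (intro sets.sets_Collect_finite_All') (use n in auto)
        then show ?thesis by (simp add: I_def atLeastLessThanSuc_atLeastAtMost)
      qed
      have IM [measurable]: "I j \<in> sets M" for j
      proof -
        have "{\<omega> \<in> space M. norm (Z i \<omega> - m) \<le> 1} \<in> sets M" if "i \<in> {N..<j}" for i
        proof -
          have [measurable]: "Z i \<in> borel_measurable M" using Z_measurable[of i] that assms by simp
          show ?thesis by measurable
        qed
        then show ?thesis unfolding I_def
          by (cases "{N..<j} = {}") (auto intro!: sets.sets_Collect_finite_All')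
      qed
      note [measurable] = Z_measurable[OF n(1)]
      let ?f = "\<lambda>z x. ennreal (exp (l (Suc n) * (norm (z + \<gamma> n *\<^sub>R sgn (x - z) - m))\<^sup>2))"
      have "E (Suc n) = (\<integral>\<^sup>+\<omega>. indicator (I (Suc n)) \<omega> * ?f (Z n \<omega>) (Xs (Suc n) \<omega>) \<partial>M)"
        unfolding E_def by (intro nn_integral_cong) (simp add: Z_Suc[OF n(1)])
      also have "\<dots> = (\<integral>\<^sup>+\<omega>. indicator (I (Suc n)) \<omega> * (\<integral>\<^sup>+x. ?f (Z n \<omega>) x \<partial>P) \<partial>M)"
        by (rule nn_integral_past[OF _ Z_past n(1)]) (use n in measurable)
      also have "\<dots> \<le> (\<integral>\<^sup>+\<omega>. ennreal (1 - e n) * (indicator (I n) \<omega> * ennreal (exp (l n * (norm (Z n \<omega> - m))\<^sup>2)))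
          + ennreal (e n * exp 1) \<partial>M)"
      proof (rule nn_integral_mono)
        fix \<omega> assume \<omega>: "\<omega> \<in> space M"
        show "indicator (I (Suc n)) \<omega> * (\<integral>\<^sup>+x. ?f (Z n \<omega>) x \<partial>P)
          \<le> ennreal (1 - e n) * (indicator (I n) \<omega> * ennreal (exp (l n * (norm (Z n \<omega> - m))\<^sup>2))) + ennreal (e n * exp 1)"
        proof (cases "\<omega> \<in> I (Suc n)")
          case True
          then have In: "\<omega> \<in> I n" and near: "norm (Z n \<omega> - m) \<le> 1"
            using n by (auto simp: I_def)
          have "l (Suc n) * (\<gamma> n)\<^sup>2 = (\<gamma> n / (2 * \<gamma> (Suc n))) * e n"
            using n g by (simp add: l_def e_def step_eq[symmetric] power2_eq_square field_simps)
          also have "\<dots> \<le> 1 * e n"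
            using ratio g c k by (intro mult_right_mono) (auto simp: e_def)
          finally have noise: "l (Suc n) * (\<gamma> n)\<^sup>2 \<le> e n" by simp
          have "2 * l (Suc n) * \<gamma> n = c * (\<gamma> n / (2 * \<gamma> (Suc n)))"
            by (simp add: l_def)
          also have "\<dots> \<le> c * 1"
            using ratio g c by (intro mult_left_mono) auto
          finally have "2 * l (Suc n) * \<gamma> n \<le> c" by simp
          then have "(\<integral>\<^sup>+x. ?f (Z n \<omega>) x \<partial>P)
              \<le> ennreal ((1 - e n) * exp (l n * (norm (Z n \<omega> - m))\<^sup>2) + e n * exp 1)"
            using N0[OF that] g l near noise c k
            by (intro law.exp_norm_step[OF coercive]) (auto simp: e_def)
          also have "\<dots> = ennreal (1 - e n) * ennreal (exp (l n * (norm (Z n \<omega> - m))\<^sup>2)) + ennreal (e n * exp 1)"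
            using N0[OF that] c k by (subst ennreal_plus) (auto simp: ennreal_mult e_def)
          finally show ?thesis using True In by simp
        qed simp
      qed
      also have "\<dots> = ennreal (1 - e n) * E n + ennreal (e n * exp 1)"
        unfolding E_def by (subst nn_integral_add) (auto simp: nn_integral_cmult M.emeasure_space_1)
      finally show ?thesis .
    qed
    show "\<not> summable e"
    proof
      assume "summable e"
      then have "summable (\<lambda>n. 2 / (c * k) * e n)" by (rule summable_mult)
      then have "summable (\<lambda>n. real n powr (- a))" using c k by (simp add: e_def)
      then show False using a by (simp add: summable_real_powr_iff)
    qed
  qed (use N0 c k in \<open>auto simp: e_def\<close>)
  then show ?thesis by (simp add: E_def I_def l_def)
qed

text \<open>Outside the ball of this radius the exponent \<open>\<lambda>\<^sub>n |V\<^sub>n|\<^sup>2\<close> is at least \<open>3 L\<^sup>2\<close>, hence at least \<open>3 L\<close>, for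
  \<open>L = ln (4 / \<delta>) \<ge> 1\<close>. Markov's inequality then bounds the probability by a multiple of
  \<open>(\<delta> / 4)\<^sup>3\<close>. The other half of \<open>\<delta>\<close> is spent on localization.\<close>

lemma confidence_ball:
  assumes "0 < \<delta>" "\<delta> < 1"
  shows "\<exists>N\<ge>1. \<forall>n\<ge>N. 1 - \<delta> \<le>
    M.prob {\<omega> \<in> space M. norm (Z n \<omega> - m) \<le> sqrt (12 * k / c) / real n powr (a / 2) * ln (4 / \<delta>)}"
proof -
  define L where "L = ln (4 / \<delta>)"
  define K where "K = sqrt (12 * k / c)"
  have L: "1 \<le> L"
  proof -
    have "exp 1 \<le> 4 / \<delta>" using mult_mono[of \<delta> 1 "exp 1" 3] exp_le assms by (simp add: field_simps)
    then show ?thesis using assms by (simp add: L_def ln_ge_iff)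
  qed
  obtain N where N: "1 \<le> N" "M.prob {\<omega> \<in> space M. \<exists>n\<ge>N. 1 < norm (Z n \<omega> - m)} \<le> \<delta> / 2"
    by (rule localization[of "\<delta> / 2", OF half_gt_zero[OF assms(1)]]) (rule that, assumption+)
  obtain N' where N': "\<And>n. N' \<le> n \<Longrightarrow> (\<integral>\<^sup>+\<omega>. indicator {\<omega> \<in> space M. \<forall>j\<in>{N..<n}. norm (Z j \<omega> - m) \<le> 1} \<omega>
      * ennreal (exp (c / (4 * \<gamma> n) * (norm (Z n \<omega> - m))\<^sup>2)) \<partial>M) \<le> ennreal (exp 1 + 1)"
    using localized_exponential_moment[OF N(1)] unfolding eventually_sequentially by blast
  have "1 - \<delta> \<le> M.prob {\<omega> \<in> space M. norm (Z n \<omega> - m) \<le> K / real n powr (a / 2) * L}" if n: "max N N' \<le> n" for n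
  proof -
    have n1: "1 \<le> n" using n N by simp
    have measM: "{\<omega> \<in> space M. Q (Z j \<omega>)} \<in> M.events" if "N \<le> j" "Measurable.pred borel Q" for j Q
    proof -
      have [measurable]: "Z j \<in> borel_measurable M" using Z_measurable N that by simp
      note [measurable] = that(2)
      show ?thesis by measurable
    qed
    note [measurable] = Z_measurable[OF n1]
    define r where "r = K / real n powr (a / 2) * L"
    define F where "F = {\<omega> \<in> space M. \<exists>n\<ge>N. 1 < norm (Z n \<omega> - m)}"
    define I where "I = {\<omega> \<in> space M. \<forall>j\<in>{N..<n}. norm (Z j \<omega> - m) \<le> 1}"
    define G where "G = {\<omega> \<in> I. r < norm (Z n \<omega> - m)}"
    have F [measurable]: "F \<in> M.events"
    proof -
      have "{\<omega> \<in> space M. 1 < norm (Z (i + N) \<omega> - m)} \<in> M.events" for i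
        using measM[of "i + N" "\<lambda>v. 1 < norm (v - m)"] by simp
      then have "(\<Union>i. {\<omega> \<in> space M. 1 < norm (Z (i + N) \<omega> - m)}) \<in> M.events" by blast
      also have "(\<Union>i. {\<omega> \<in> space M. 1 < norm (Z (i + N) \<omega> - m)}) = F"
        unfolding F_def by (rule exceeds_from)
      finally show ?thesis .
    qed
    have I [measurable]: "I \<in> M.events"
    proof -
      have "{\<omega> \<in> space M. norm (Z i \<omega> - m) \<le> 1} \<in> sets M" if "i \<in> {N..<n}" for i
        using measM[of i "\<lambda>v. norm (v - m) \<le> 1"] that by simp
      then show ?thesis unfolding I_def
        by (cases "{N..<n} = {}") (auto intro!: sets.sets_Collect_finite_All')
    qed
    have G [measurable]: "G \<in> M.events"
    proof -
      have "G = I \<inter> {\<omega> \<in> space M. r < norm (Z n \<omega> - m)}" by (auto simp: G_def I_def)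
      also have "\<dots> \<in> M.events" by measurable
      finally show ?thesis .
    qed
    have "emeasure M G = (\<integral>\<^sup>+\<omega>. indicator G \<omega> \<partial>M)" by simp
    also have "\<dots> \<le> (\<integral>\<^sup>+\<omega>. ennreal ((\<delta> / 4) ^ 3) * (indicator I \<omega> * ennreal (exp (c / (4 * \<gamma> n) * (norm (Z n \<omega> - m))\<^sup>2))) \<partial>M)"
    proof (rule nn_integral_mono)
      fix \<omega>
      have "1 \<le> (\<delta> / 4) ^ 3 * exp (c / (4 * \<gamma> n) * (norm (Z n \<omega> - m))\<^sup>2)" if "r < norm (Z n \<omega> - m)"
      proof -
        have "(4 / \<delta>) ^ 3 = exp (3 * L)"
          using assms exp_of_nat_mult[of 3 L] by (simp add: L_def)
        also have "3 * L \<le> 3 * L\<^sup>2"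
          using L by (simp add: power2_eq_square mult_le_cancel_left1)
        also have "3 * L\<^sup>2 = c / (4 * \<gamma> n) * r\<^sup>2"
        proof -
          have "(real n powr (a / 2))\<^sup>2 = real n powr a"
            using n1 by (simp add: power2_eq_square powr_add[symmetric])
          moreover have "K\<^sup>2 = 12 * k / c"
            unfolding K_def using k c by (intro real_sqrt_pow2) simp
          ultimately have "r\<^sup>2 = 12 * k / c / real n powr a * L\<^sup>2"
            by (simp only: r_def power_mult_distrib power_divide)
          also have "\<dots> = 12 / c * \<gamma> n * L\<^sup>2"
            by (simp only: step_eq[OF n1] powr_minus_divide times_divide_eq_left times_divide_eq_right mult_1_right mult_1_left divide_divide_eq_left mult.commute)
          finally have "r\<^sup>2 = 12 / c * \<gamma> n * L\<^sup>2" .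
          then show ?thesis using c step_pos[OF n1] by simp
        qed
        also have "c / (4 * \<gamma> n) * r\<^sup>2 \<le> c / (4 * \<gamma> n) * (norm (Z n \<omega> - m))\<^sup>2"
        proof -
          have "0 \<le> r" using k c L by (simp add: r_def K_def)
          then show ?thesis using c step_pos[OF n1] that by (intro mult_left_mono power_mono) auto
        qed
        finally have "(\<delta> / 4) ^ 3 * (4 / \<delta>) ^ 3 \<le> (\<delta> / 4) ^ 3 * exp (c / (4 * \<gamma> n) * (norm (Z n \<omega> - m))\<^sup>2)"
          using assms by (intro mult_left_mono) auto
        then show ?thesis using assms by (simp add: power_mult_distrib[symmetric])
      qed
      then have "(1::ennreal) \<le> ennreal ((\<delta> / 4) ^ 3) * ennreal (exp (c / (4 * \<gamma> n) * (norm (Z n \<omega> - m))\<^sup>2))"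
        if "r < norm (Z n \<omega> - m)"
        using that assms by (subst ennreal_mult'[symmetric]) (auto simp: ennreal_1[symmetric] simp del: ennreal_1 intro!: ennreal_leI)
      then show "indicator G \<omega> \<le> ennreal ((\<delta> / 4) ^ 3) * (indicator I \<omega> * ennreal (exp (c / (4 * \<gamma> n) * (norm (Z n \<omega> - m))\<^sup>2)))"
        by (auto simp: indicator_def G_def)
    qed
    also have "\<dots> = ennreal ((\<delta> / 4) ^ 3) * (\<integral>\<^sup>+\<omega>. indicator I \<omega> * ennreal (exp (c / (4 * \<gamma> n) * (norm (Z n \<omega> - m))\<^sup>2)) \<partial>M)"
      by (rule nn_integral_cmult) measurable
    also have "\<dots> \<le> ennreal ((\<delta> / 4) ^ 3) * ennreal (exp 1 + 1)"
      unfolding I_def using n by (intro mult_left_mono N') auto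
    also have "\<dots> = ennreal ((\<delta> / 4) ^ 3 * (exp 1 + 1))"
      using assms by (subst ennreal_mult) auto
    also have "\<dots> \<le> ennreal (\<delta> / 2)"
    proof (rule ennreal_leI)
      have "(\<delta> / 4) ^ 3 * (exp 1 + 1) \<le> (\<delta> / 4) ^ 3 * 4"
        using exp_le assms by (intro mult_left_mono) auto
      also have "\<dots> = \<delta> / 2 * (\<delta> * \<delta> / 8)" by (simp add: power3_eq_cube)
      also have "\<dots> \<le> \<delta> / 2 * 1"
        using assms mult_strict_mono[of \<delta> 1 \<delta> 1] by (intro mult_left_mono) auto
      finally show "(\<delta> / 4) ^ 3 * (exp 1 + 1) \<le> \<delta> / 2" by simp
    qed
    finally have PG: "M.prob G \<le> \<delta> / 2" using assms by (simp add: M.emeasure_eq_measure)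
    have "space M - {\<omega> \<in> space M. norm (Z n \<omega> - m) \<le> r} \<subseteq> F \<union> G"
      using n by (auto simp: F_def G_def I_def not_le not_less)
    then have "M.prob (space M - {\<omega> \<in> space M. norm (Z n \<omega> - m) \<le> r}) \<le> M.prob (F \<union> G)"
      by (intro M.finite_measure_mono) auto
    also have "\<dots> \<le> M.prob F + M.prob G"
      by (rule measure_Un_le) auto
    also have "\<dots> \<le> \<delta>" using PG N(2) by (simp add: F_def)
    finally have "M.prob (space M - {\<omega> \<in> space M. norm (Z n \<omega> - m) \<le> r}) \<le> \<delta>" .
    then show ?thesis
      unfolding r_def[symmetric] by (subst (asm) M.prob_compl) auto
  qed
  then show ?thesis
    unfolding K_def L_def using N(1) by (intro exI[of _ "max N N'"]) auto
qed

end

section \<open>From the hypotheses on the random variable to its law\<close>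

lemma ext_variance_AE_const:
  assumes "prob_space M" "Y \<in> borel_measurable M" "AE \<omega> in M. Y \<omega> = b"
  shows "ext_variance M Y = 0"
proof -
  interpret prob_space M by fact
  have int: "integrable M Y"
    using integrable_cong_AE[of Y M "\<lambda>_. b"] assms by simp
  have E: "integral\<^sup>L M Y = b"
    using integral_cong_AE[of Y M "\<lambda>_. b"] assms by (simp add: prob_space)
  have "(\<integral>\<^sup>+\<omega>. ennreal ((Y \<omega> - b)\<^sup>2) \<partial>M) = (\<integral>\<^sup>+\<omega>. 0 \<partial>M)"
    using assms(3) by (intro nn_integral_cong_AE) auto
  then show ?thesis using int E by (simp add: ext_variance_def)
qed

text \<open>If \<open>X - m\<close> were almost surely on the line spanned by \<open>u\<close>, then every \<open>h'\<close> orthogonal to \<open>u\<close> would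
  satisfy \<open>\<langle>h', X\<rangle> = \<langle>h', m\<rangle>\<close> almost surely and have variance \<open>0\<close>. The absence of an atom at \<open>m\<close>
  follows from the inverse moment, because \<open>inverse 0 = \<infinity>\<close> in the extended reals.\<close>

lemma median_law_distr:
  fixes X :: "'a \<Rightarrow> 'h::{real_inner, complete_space, second_countable_topology}"
  assumes "prob_space M" and X [measurable]: "X \<in> borel_measurable M"
    and not_line: "\<And>h. \<exists>h'. inner h h' = 0 \<and> ext_variance M (\<lambda>\<omega>. inner h' (X \<omega>)) > 0"
    and inv: "(\<integral>\<^sup>+ \<omega>. inverse (ennreal (norm (X \<omega> - m))) \<partial>M) < \<infinity>"
    and med: "is_geometric_median M X m"
  shows "median_law (distr M borel X) m"
proof -
  interpret M: prob_space M by fact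
  interpret P: prob_space "distr M borel X" by (rule M.prob_space_distr) (rule X)
  show ?thesis
  proof
    show "sets (distr M borel X) = sets borel" by simp
    have "AE \<omega> in M. inverse (ennreal (norm (X \<omega> - m))) \<noteq> \<infinity>"
      using inv by (intro nn_integral_noteq_infinite) auto
    then have "AE \<omega> in M. X \<omega> \<noteq> m"
      by eventually_elim auto
    then show "AE x in distr M borel X. x \<noteq> m"
      by (subst AE_distr_iff) auto
    show "\<not> (AE x in distr M borel X. gram u (x - m) = 0)" if "u \<noteq> 0" for u
    proof
      assume "AE x in distr M borel X. gram u (x - m) = 0"
      then have ae: "AE \<omega> in M. gram u (X \<omega> - m) = 0"
        by (subst (asm) AE_distr_iff) auto
      obtain h' where h': "inner u h' = 0" "ext_variance M (\<lambda>\<omega>. inner h' (X \<omega>)) > 0"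
        using not_line by blast
      from ae have "AE \<omega> in M. inner h' (X \<omega>) = inner h' m"
      proof eventually_elim
        case (elim \<omega>)
        then show ?case
          using gram_eq_0_orthogonal[OF that elim h'(1)] by (simp add: inner_diff)
      qed
      then have "ext_variance M (\<lambda>\<omega>. inner h' (X \<omega>)) = 0"
        by (intro ext_variance_AE_const assms(1)) auto
      then show False using h'(2) by simp
    qed
    show "(\<integral>x. norm (x - m) - norm x \<partial>distr M borel X) \<le> (\<integral>x. norm (x - h) - norm x \<partial>distr M borel X)" for h
      using med unfolding is_geometric_median_def is_arg_min_def
      by (subst (1 2) integral_distr) (auto simp: not_less)
  qed
qed

theorem theorem4p1:
  fixes M :: "'a measure"
    and X :: "'a \<Rightarrow> 'h::{real_inner, complete_space, second_countable_topology}"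
    and Xs Z :: "nat \<Rightarrow> 'a \<Rightarrow> 'h"
    and m :: 'h
    and \<gamma> :: "nat \<Rightarrow> real"
    and C \<alpha> c\<^sub>\<gamma> :: real
  assumes "prob_space M"
    and "X \<in> borel_measurable M"
    and "prob_space.indep_vars M (\<lambda>_. borel) Xs {1..}"
    and "\<forall>n\<ge>1. distr M borel (Xs n) = distr M borel X"
    and "\<forall>h. \<exists>h'. inner h h' = 0 \<and> ext_variance M (\<lambda>\<omega>. inner h' (X \<omega>)) > 0"
    and "C > 0"
    and "\<forall>h. (\<integral>\<^sup>+ \<omega>. inverse (ennreal (norm (X \<omega> - h))) \<partial>M) \<le> ennreal C"
    and "\<forall>h. (\<integral>\<^sup>+ \<omega>. inverse (ennreal ((norm (X \<omega> - h))\<^sup>2)) \<partial>M) \<le> ennreal C"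
    and "is_geometric_median M X m"
    and "1 / 2 < \<alpha>" "\<alpha> < 1"
    and "c\<^sub>\<gamma> > 0"
    and "\<forall>n\<ge>1. \<gamma> n = c\<^sub>\<gamma> * real n powr (- \<alpha>)"
    and "Z 1 \<in> borel_measurable (vimage_algebra (space M) (Xs 1) borel)"
    and "bounded (Z 1 ` space M)"
    and "\<forall>n\<ge>1. \<forall>\<omega>\<in>space M.
           Z (n + 1) \<omega> =
             Z n \<omega> + \<gamma> n *\<^sub>R ((Xs (n + 1) \<omega> - Z n \<omega>) /\<^sub>R norm (Xs (n + 1) \<omega> - Z n \<omega>))"
  shows "\<exists>K>0. \<forall>\<delta>. 0 < \<delta> \<and> \<delta> < 1 \<longrightarrow>
           (\<exists>n\<^sub>\<delta>\<ge>1. \<forall>n\<ge>n\<^sub>\<delta>.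
              measure M {\<omega> \<in> space M. norm (Z n \<omega> - m) \<le> K / real n powr (\<alpha> / 2) * ln (4 / \<delta>)}
                \<ge> 1 - \<delta>)"
proof -
  interpret M: prob_space M by (rule assms(1))
  let ?P = "distr M borel X"
  have "(\<integral>\<^sup>+ \<omega>. inverse (ennreal (norm (X \<omega> - m))) \<partial>M) < \<infinity>"
    using assms(7) by (auto intro: le_less_trans)
  then interpret law: median_law ?P m
    using assms by (intro median_law_distr) auto
  obtain c where c: "0 < c" "\<And>v. c * min ((norm v)\<^sup>2) (norm v) \<le> law.pull v"
    using law.pull_coercive by blast
  interpret median_recursion_powr M ?P m Xs Z \<gamma> \<alpha> c\<^sub>\<gamma> c
  proof unfold_locales
    show "Z (Suc n) \<omega> = Z n \<omega> + \<gamma> n *\<^sub>R sgn (Xs (Suc n) \<omega> - Z n \<omega>)"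
      if "1 \<le> n" "\<omega> \<in> space M" for n \<omega>
      using assms(16) that by (simp add: sgn_div_norm)
  qed (use assms c in auto)
  have "0 < sqrt (12 * c\<^sub>\<gamma> / c)"
    using c assms by simp
  then show ?thesis
    using confidence_ball by blast
qed

end
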